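(* Let $k$ and $N$ be positive integers with $k \mid N$, and let $f$ be a $k$-link function. Then the complex companion ensembles $\tilde{M}_{f,k}$ (of size $k\times k$) and $\tilde{M}_{f,N}$ (of size $N\times N$) have the same eigenvalue distribution.
   Context: Matrices are zero-indexed: the entries of an $N\times N$ matrix are indexed by pairs in $\{0,\dots,N-1\}^2$. Gaussians: $\mathcal{N}_{\mathbb{R}}(0,1)$ is the real Gaussian law of mean $0$ and variance $1$; $\mathcal{N}_{\mathbb{C}}(0,1)$ is the law of $(a+ib)/\sqrt{2}$ with $a,b$ i.i.d. $\mathcal{N}_{\mathbb{R}}(0,1)$. $k$-link function: any function $f:(\mathbb{Z}/k\mathbb{Z})^2\to\mathbb{Z}/k\mathbb{Z}$; it is also treated as a function on $\mathbb{Z}^2$ by first reducing both integers mod $k$. Complex companion ensemble: given positive integers $k\mid N$ and a $k$-link function $f$, the $N\times N$ complex companion ensemble $\tilde{M}_{f,N}$ is the $N\times N$ Hermitian random matrix ensemble with entries $c_{\ell,j}$ distributed as $c_{\ell,j}\sim\mathcal{N}_{\mathbb{R}}(0,1)$ if $2(j-\ell)\equiv 0\pmod N$ and $f(j,\ell)=f(\ell,j)$, and $c_{\ell,j}\sim\mathcal{N}_{\mathbb{C}}(0,1)$ otherwise, which are independent apart from the following restrictions: (1) $c_{\ell,j}=\overline{c_{j,\ell}}$ (i.e. the ensemble is Hermitian); (2) $c_{\ell,j}=c_{m,n}$ if $\ell-j\equiv m-n\pmod N$ and $f(\ell,j)=f(m,n)$. The ensemble $\tilde{M}_{f,k}$ is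 the case $N=k$. Eigenvalue distribution: for an $n\times n$ Hermitian random matrix ensemble $M_n$, the eigenvalue distribution $\mu_{M_n}$ is the probability measure on $\mathbb{R}$ that is the law of the real random variable obtained by choosing a matrix according to $M_n$, then choosing one of its $n$ eigenvalues (with multiplicity) uniformly at random, and multiplying it by $1/\sqrt{n}$. *)

theory Defs
  imports
    "HOL-Probability.Probability"
    "HOL-Number_Theory.Cong"
    "Jordan_Normal_Form.Char_Poly"
begin

text \<open>Elements of \<open>\<int>/k\<int>\<close> are represented by their residues in \<open>{0..<k}\<close>.\<close>

definition link_function :: "nat \<Rightarrow> (int \<times> int \<Rightarrow> int) \<Rightarrow> bool" where
  "link_function k f \<longleftrightarrow> f \<in> {0..<int k} \<times> {0..<int k} \<rightarrow> {0..<int k}"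

definition link_at :: "nat \<Rightarrow> (int \<times> int \<Rightarrow> int) \<Rightarrow> nat \<Rightarrow> nat \<Rightarrow> int" where
  "link_at k f l j = f (int l mod int k, int j mod int k)"

definition real_gaussian :: "real measure" where
  "real_gaussian = density lborel std_normal_density"

definition complex_gaussian :: "complex measure" where
  "complex_gaussian =
     distr (real_gaussian \<Otimes>\<^sub>M real_gaussian) borel
       (\<lambda>(a, b). (complex_of_real a + \<i> * complex_of_real b) / complex_of_real (sqrt 2))"

text \<open>The law of the \<open>(l, j)\<close> entry; the real Gaussian is viewed as a law on \<open>\<complex>\<close>.\<close>

definition entry_law :: "nat \<Rightarrow> (int \<times> int \<Rightarrow> int) \<Rightarrow> nat \<Rightarrow> nat \<Rightarrow> nat \<Rightarrow> complex measure" where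
  "entry_law k f N l j =
     (if [2 * (int j - int l) = 0] (mod int N) \<and> link_at k f j l = link_at k f l j
      then distr real_gaussian borel complex_of_real
      else complex_gaussian)"

definition same_entry ::
    "nat \<Rightarrow> (int \<times> int \<Rightarrow> int) \<Rightarrow> nat \<Rightarrow> nat \<times> nat \<Rightarrow> nat \<times> nat \<Rightarrow> bool" where
  "same_entry k f N = (\<lambda>(l, j) (m, n).
     [int l - int j = int m - int n] (mod int N) \<and> link_at k f l j = link_at k f m n)"

text \<open>Two positions are linked if a chain of the imposed relations (equality of entries, and
  conjugation across the diagonal) connects them inside the \<open>N \<times> N\<close> matrix.\<close>

inductive linked :: "nat \<Rightarrow> (int \<times> int \<Rightarrow> int) \<Rightarrow> nat \<Rightarrow> nat \<times> nat \<Rightarrow> nat \<times> nat \<Rightarrow> bool"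
  for k f N where
  refl: "p \<in> {0..<N} \<times> {0..<N} \<Longrightarrow> linked k f N p p"
| conj: "linked k f N p (l, j) \<Longrightarrow> linked k f N p (j, l)"
| same: "linked k f N p q \<Longrightarrow> r \<in> {0..<N} \<times> {0..<N} \<Longrightarrow> same_entry k f N q r \<Longrightarrow> linked k f N p r"

text \<open>\<open>M\<close>, a random matrix on the probability space \<open>P\<close>, is distributed as the \<open>N \<times> N\<close> complex
  companion ensemble of the \<open>k\<close>-link function \<open>f\<close>. ``Independent apart from the restrictions''
  means that entries at pairwise unlinked positions are (jointly) independent.
  For certain \<open>f\<close> the prescribed laws contradict the restrictions (a chain of restrictions forces
  an entry to be real although its prescribed law is the complex Gaussian); then no such \<open>M\<close>
  exists.\<close>

definition complex_companion_ensemble ::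
    "nat \<Rightarrow> (int \<times> int \<Rightarrow> int) \<Rightarrow> nat \<Rightarrow> 'a measure \<Rightarrow> ('a \<Rightarrow> complex mat) \<Rightarrow> bool" where
  "complex_companion_ensemble k f N P M \<longleftrightarrow>
     prob_space P \<and>
     (\<forall>\<omega>\<in>space P. M \<omega> \<in> carrier_mat N N) \<and>
     (\<forall>l<N. \<forall>j<N. (\<lambda>\<omega>. M \<omega> $$ (l, j)) \<in> borel_measurable P \<and>
        distr P borel (\<lambda>\<omega>. M \<omega> $$ (l, j)) = entry_law k f N l j) \<and>
     (\<forall>\<omega>\<in>space P. \<forall>l<N. \<forall>j<N. M \<omega> $$ (l, j) = cnj (M \<omega> $$ (j, l))) \<and>
     (\<forall>\<omega>\<in>space P. \<forall>l<N. \<forall>j<N. \<forall>m<N. \<forall>n<N.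
        same_entry k f N (l, j) (m, n) \<longrightarrow> M \<omega> $$ (l, j) = M \<omega> $$ (m, n)) \<and>
     (\<forall>R \<subseteq> {0..<N} \<times> {0..<N}. pairwise (\<lambda>p q. \<not> linked k f N p q) R \<longrightarrow>
        prob_space.indep_vars P (\<lambda>_. borel) (\<lambda>p \<omega>. M \<omega> $$ p) R)"

text \<open>Draw \<open>M \<omega>\<close>, then one of its \<open>n\<close> eigenvalues (roots of the characteristic polynomial, with
  multiplicity) uniformly, and divide it by \<open>sqrt n\<close>. For Hermitian matrices \<open>Re\<close> is only the
  passage from \<open>\<complex>\<close> to \<open>\<real>\<close>, as the eigenvalues are real.\<close>

definition eigenvalue_distribution ::
    "nat \<Rightarrow> 'a measure \<Rightarrow> ('a \<Rightarrow> complex mat) \<Rightarrow> real measure" where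
  "eigenvalue_distribution n P M =
     P \<bind> (\<lambda>\<omega>. distr (measure_pmf (pmf_of_multiset (proots (char_poly (M \<omega>))))) borel
                 (\<lambda>x. Re x / sqrt (real n)))"

end

theory Submission
  imports Defs "Jordan_Normal_Form.Schur_Decomposition"
begin

text \<open>
  Every sample of the \<open>N \<times> N\<close> ensemble commutes with the cyclic shift by \<open>k\<close>. With \<open>m = N / k\<close>, the
  discrete Fourier transform splits it into the \<open>m\<close> blocks
  \<open>F\<^sub>s(i, j) = \<Sum>u. exp (2 \<pi> \<i> s (u - i) / N) c(i, u)\<close> of size \<open>k\<close>, where \<open>u < N\<close> runs over the residue
  class of \<open>j\<close> modulo \<open>k\<close>. The map \<open>c \<mapsto> F\<^sub>s\<close> is multiplicative and the traces of the blocks add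
  up to the trace of the whole, so by power sums the spectrum is the union of the spectra of the blocks.

  It remains to see that each \<open>F\<^sub>s / sqrt m\<close> has the law of the \<open>k \<times> k\<close> ensemble. Both are centred
  Gaussian, so by characteristic functions their laws are determined by the covariances
  \<open>E[c(p) cnj c(q)]\<close>. In a companion ensemble this is 1 if \<open>p\<close> and \<open>q\<close> are connected by a chain of links
  with an even number of conjugations, and 0 otherwise. Even chains of size \<open>N\<close> project to even chains
  of size \<open>k\<close> and lift back uniquely once the difference of indices modulo \<open>N\<close> is prescribed; the
  phases cancel along a lift.
\<close>

section \<open>Characteristic functions and joint laws\<close>

text \<open>The theorem compares mean spectral measures, and integration is linear, so it is enough
  that every block separately has the law of the small ensemble; the joint law of the
  \<open>m\<close> blocks never enters. A centred complex Gaussian vector is in general described by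
  \<open>E[c(p) cnj c(q)]\<close> together with \<open>E[c(p) c(q)]\<close>; Hermitian symmetry
  makes \<open>c(q)\<close> the conjugate of the transposed entry, so the former suffice. The parity
  of chains has to be tracked because an odd chain conjugates the entry and contributes
  \<open>E[z^2]\<close>, which is 0 for the complex Gaussian. Where the real Gaussian is prescribed,
  the position has an odd chain to itself, so every position linked to it is also linked by an even
  chain and the same covariance formula holds. The two ensembles may live on different probability
  spaces, so expectations are compared through the joint laws of real coordinates. Eigenvalues are
  never ordered or chosen measurably: measurability of the spectral law comes from traces of powers,
  which are polynomials in the entries.\<close>

lemma borel_measurable_cnj [measurable]: "cnj \<in> borel_measurable borel"
  by (intro borel_measurable_continuous_onI continuous_intros)

lemma char_distr_density:
  fixes X h :: "'a \<Rightarrow> real"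
  assumes X: "X \<in> borel_measurable M" and h: "h \<in> borel_measurable M" "\<And>x. h x \<ge> 0"
  shows "char (distr (density M (\<lambda>x. ennreal (h x))) borel X) t
    = (CLINT x|M. of_real (h x) * iexp (t * X x))"
proof -
  have [measurable]: "X \<in> borel_measurable M" "h \<in> borel_measurable M" using X h by auto
  have "char (distr (density M (\<lambda>x. ennreal (h x))) borel X) t
    = (CLINT x|density M (\<lambda>x. ennreal (h x)). iexp (t * X x))"
    unfolding char_def by (subst integral_distr) auto
  also have "\<dots> = (CLINT x|M. h x *\<^sub>R iexp (t * X x))"
    by (rule integral_density) (use h in auto)
  finally show ?thesis by (simp add: scaleR_conv_of_real)
qed

text \<open>The weight may change sign, so the measure with density \<open>f\<close> is replaced by
  the one with density \<open>2 + f\<close>, which is positive and can be normalized to a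
  probability measure. Levy uniqueness identifies the images of these measures, and subtracting
  twice the unweighted laws, equal by \<open>char\<close>, recovers \<open>f\<close>.\<close>

lemma weighted_law_eqI_real:
  fixes X f :: "'a \<Rightarrow> real" and Y g :: "'b \<Rightarrow> real"
  assumes P: "prob_space P" and Q: "prob_space Q"
    and meas: "X \<in> borel_measurable P" "f \<in> borel_measurable P"
      "Y \<in> borel_measurable Q" "g \<in> borel_measurable Q"
    and bound: "\<And>x. \<bar>f x\<bar> \<le> 1" "\<And>y. \<bar>g y\<bar> \<le> 1"
    and char: "\<And>t. (CLINT x|P. iexp (t * X x)) = (CLINT y|Q. iexp (t * Y y))"
    and wchar: "\<And>t. (CLINT x|P. of_real (f x) * iexp (t * X x))
      = (CLINT y|Q. of_real (g y) * iexp (t * Y y))"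
    and A: "A \<in> sets borel"
  shows "(LINT x|P. f x * indicator A (X x)) = (LINT y|Q. g y * indicator A (Y y))"
proof -
  interpret P: prob_space P by fact
  interpret Q: prob_space Q by fact
  note [measurable] = meas A
  have int_f: "integrable P f" "integrable P (\<lambda>x. f x * indicator A (X x))"
    "\<And>t. integrable P (\<lambda>x. of_real (f x) * iexp (t * X x))"
    "\<And>t. integrable P (\<lambda>x. iexp (t * X x))" "integrable P (\<lambda>x. indicator A (X x) :: real)"
    using bound by (auto intro!: P.integrable_const_bound[of _ 1] AE_I2
      simp: norm_mult split: split_indicator)
  have int_g: "integrable Q g" "integrable Q (\<lambda>x. g x * indicator A (Y x))"
    "\<And>t. integrable Q (\<lambda>x. of_real (g x) * iexp (t * Y x))"
    "\<And>t. integrable Q (\<lambda>x. iexp (t * Y x))" "integrable Q (\<lambda>x. indicator A (Y x) :: real)"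
    using bound by (auto intro!: Q.integrable_const_bound[of _ 1] AE_I2
      simp: norm_mult split: split_indicator)
  \<comment> \<open>The total mass of \<open>2 + f\<close>; by \<open>wchar\<close> at frequency 0
    it is also the mass of \<open>2 + g\<close>, so both sides are normalized by the same
    constant.\<close>
  define c where "c = 2 + (LINT x|P. f x)"
  have "complex_of_real (LINT x|P. f x) = complex_of_real (LINT y|Q. g y)"
    using wchar[of 0] by simp
  then have c_g: "c = 2 + (LINT y|Q. g y)" by (simp add: c_def)
  have "(LINT x|P. -1) \<le> (LINT x|P. f x)"
    by (rule integral_mono) (use int_f(1) bound(1) in \<open>auto simp: abs_le_iff minus_le_iff\<close>)
  then have c: "c \<ge> 1" by (simp add: c_def P.prob_space)
  define h where "h x = (2 + f x) / c" for x
  define k where "k y = (2 + g y) / c" for y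
  have h0: "h x \<ge> 0" for x using bound(1)[of x] c by (auto simp: h_def abs_le_iff)
  have k0: "k y \<ge> 0" for y using bound(2)[of y] c by (auto simp: k_def abs_le_iff)
  have [measurable]: "h \<in> borel_measurable P" "k \<in> borel_measurable Q"
    unfolding h_def[abs_def] k_def[abs_def] by auto
  define M1 where "M1 = distr (density P (\<lambda>x. ennreal (h x))) borel X"
  define M2 where "M2 = distr (density Q (\<lambda>x. ennreal (k x))) borel Y"
  have int_h: "(LINT x|P. h x) = 1"
    using int_f(1) c by (simp add: h_def[abs_def] P.prob_space c_def)
  have int_k: "(LINT x|Q. k x) = 1"
    using int_g(1) c by (simp add: k_def[abs_def] Q.prob_space c_g)
  have m1: "measure M1 S = (LINT x|P. h x * indicator S (X x))" if [measurable]: "S \<in> sets borel" for S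
  proof -
    have "measure M1 S = (LINT x|M1. indicator S x)" using that by (simp add: M1_def)
    also have "\<dots> = (LINT x|P. h x * indicator S (X x))"
      unfolding M1_def by (subst integral_distr, simp, simp, subst integral_density) (auto simp: h0)
    finally show ?thesis .
  qed
  have m2: "measure M2 S = (LINT x|Q. k x * indicator S (Y x))" if [measurable]: "S \<in> sets borel" for S
  proof -
    have "measure M2 S = (LINT x|M2. indicator S x)" using that by (simp add: M2_def)
    also have "\<dots> = (LINT x|Q. k x * indicator S (Y x))"
      unfolding M2_def by (subst integral_distr, simp, simp, subst integral_density) (auto simp: k0)
    finally show ?thesis .
  qed
  have "integrable P h" "integrable Q k" using int_f(1) int_g(1)
    by (auto simp: h_def[abs_def] k_def[abs_def])
  then have "prob_space (density P (\<lambda>x. ennreal (h x)))" "prob_space (density Q (\<lambda>x. ennreal (k x)))"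
    using h0 k0 int_h int_k
    by (auto intro!: prob_spaceI simp: emeasure_density nn_integral_eq_integral cong: nn_integral_cong_simp)
  then have rd: "real_distribution M1" "real_distribution M2"
    unfolding M1_def M2_def by (auto intro!: prob_space.real_distribution_distr)
  have "char M1 = char M2"
  proof
    fix t
    have "char M1 t = (CLINT x|P. (2 * iexp (t * X x) + of_real (f x) * iexp (t * X x)) / of_real c)"
      unfolding M1_def by (subst char_distr_density, simp, simp, rule h0) (intro Bochner_Integration.integral_cong HOL.refl, simp add: h_def field_simps)
    also have "\<dots> = (2 * (CLINT x|P. iexp (t * X x)) + (CLINT x|P. of_real (f x) * iexp (t * X x))) / of_real c"
      using int_f by simp
    also have "\<dots> = (2 * (CLINT x|Q. iexp (t * Y x)) + (CLINT x|Q. of_real (g x) * iexp (t * Y x))) / of_real c"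
      by (simp only: char wchar)
    also have "\<dots> = (CLINT x|Q. (2 * iexp (t * Y x) + of_real (g x) * iexp (t * Y x)) / of_real c)"
      using int_g by simp
    also have "\<dots> = char M2 t"
      unfolding M2_def by (subst char_distr_density, simp, simp, rule k0) (intro Bochner_Integration.integral_cong HOL.refl, simp add: k_def field_simps)
    finally show "char M1 t = char M2 t" .
  qed
  then have "M1 = M2" by (rule Levy_uniqueness[OF rd])
  then have eq: "(LINT x|P. h x * indicator A (X x)) = (LINT x|Q. k x * indicator A (Y x))"
    using m1[OF A] m2[OF A] by simp
  have charX: "char (distr P borel X) t = (CLINT x|P. iexp (t * X x))"
    and charY: "char (distr Q borel Y) t = (CLINT x|Q. iexp (t * Y x))" for t
    by (simp_all add: char_def integral_distr)
  have "distr P borel X = distr Q borel Y"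
    by (rule Levy_uniqueness)
       (auto intro!: P.real_distribution_distr Q.real_distribution_distr simp: fun_eq_iff charX charY char
          simp del: of_real_mult)
  moreover have "measure (distr P borel X) A = (LINT x|P. indicator A (X x))"
    by (subst integral_distr[of X P borel "\<lambda>y. indicator A y :: real", symmetric]) auto
  moreover have "measure (distr Q borel Y) A = (LINT x|Q. indicator A (Y x))"
    by (subst integral_distr[of Y Q borel "\<lambda>y. indicator A y :: real", symmetric]) auto
  ultimately have ind: "(LINT x|P. indicator A (X x)) = (LINT x|Q. indicator A (Y x) :: real)"
    by simp
  have "(LINT x|P. f x * indicator A (X x)) = (LINT x|P. c * (h x * indicator A (X x)) - 2 * indicator A (X x))"
    using c by (intro Bochner_Integration.integral_cong) (auto simp: h_def field_simps)
  also have "\<dots> = c * (LINT x|P. h x * indicator A (X x)) - 2 * (LINT x|P. indicator A (X x))"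
    using int_f c by (subst Bochner_Integration.integral_diff) (auto simp: h_def[abs_def] ring_distribs add_divide_distrib)
  also have "\<dots> = c * (LINT x|Q. k x * indicator A (Y x)) - 2 * (LINT x|Q. indicator A (Y x))"
    by (simp only: eq ind)
  also have "\<dots> = (LINT x|Q. c * (k x * indicator A (Y x)) - 2 * indicator A (Y x))"
    using int_g c by (subst Bochner_Integration.integral_diff) (auto simp: k_def[abs_def] ring_distribs add_divide_distrib)
  also have "\<dots> = (LINT x|Q. g x * indicator A (Y x))"
    using c by (intro Bochner_Integration.integral_cong) (auto simp: k_def field_simps)
  finally show ?thesis .
qed

text \<open>Reduces to real weights: the real and imaginary parts are combinations of the weight and
  its conjugate.\<close>

lemma weighted_law_eqI:
  fixes X :: "'a \<Rightarrow> real" and f :: "'a \<Rightarrow> complex" and Y :: "'b \<Rightarrow> real" and g :: "'b \<Rightarrow> complex"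
  assumes P: "prob_space P" and Q: "prob_space Q"
    and meas: "X \<in> borel_measurable P" "f \<in> borel_measurable P"
      "Y \<in> borel_measurable Q" "g \<in> borel_measurable Q"
    and bound: "\<And>x. norm (f x) \<le> 1" "\<And>y. norm (g y) \<le> 1"
    and char: "\<And>t. (CLINT x|P. iexp (t * X x)) = (CLINT y|Q. iexp (t * Y y))"
    and wchar: "\<And>t. (CLINT x|P. f x * iexp (t * X x)) = (CLINT y|Q. g y * iexp (t * Y y))"
    and A: "A \<in> sets borel"
  shows "(CLINT x|P. f x * indicator A (X x)) = (CLINT y|Q. g y * indicator A (Y y))"
proof -
  interpret P: prob_space P by fact
  interpret Q: prob_space Q by fact
  note [measurable] = meas A
  have int: "\<And>t. integrable P (\<lambda>x. f x * iexp (t * X x))" "integrable P (\<lambda>x. f x * indicator A (X x))"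
    "\<And>t. integrable P (\<lambda>x. cnj (f x) * iexp (t * X x))"
    using bound by (auto intro!: P.integrable_const_bound[of _ 1] AE_I2
      simp: norm_mult split: split_indicator)
  have int': "\<And>t. integrable Q (\<lambda>x. g x * iexp (t * Y x))" "integrable Q (\<lambda>x. g x * indicator A (Y x))"
    "\<And>t. integrable Q (\<lambda>x. cnj (g x) * iexp (t * Y x))"
    using bound by (auto intro!: Q.integrable_const_bound[of _ 1] AE_I2
      simp: norm_mult split: split_indicator)
  \<comment> \<open>Conjugation reverses the frequency, so the conjugate weight is handled by
    \<open>wchar\<close> at \<open>- t\<close>.\<close>
  have cw: "(CLINT x|P. cnj (f x) * iexp (t * X x)) = (CLINT y|Q. cnj (g y) * iexp (t * Y y))" for t
  proof -
    have "cnj (CLINT x|P. f x * iexp (- t * X x)) = (CLINT x|P. cnj (f x) * iexp (t * X x))"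
      by (subst Bochner_Integration.integral_cnj[symmetric]) (auto intro!: Bochner_Integration.integral_cong simp: exp_cnj)
    moreover have "cnj (CLINT x|Q. g x * iexp (- t * Y x)) = (CLINT x|Q. cnj (g x) * iexp (t * Y x))"
      by (subst Bochner_Integration.integral_cnj[symmetric]) (auto intro!: Bochner_Integration.integral_cong simp: exp_cnj)
    ultimately show ?thesis using wchar[of "-t"] by simp
  qed
  have re: "complex_of_real (Re z) = (z + cnj z) / 2" and im: "complex_of_real (Im z) = (z - cnj z) / (2 * \<i>)" for z
    by (auto simp: complex_eq_iff)
  have 1: "(LINT x|P. Re (f x) * indicator A (X x)) = (LINT y|Q. Re (g y) * indicator A (Y y))"
  proof (rule weighted_law_eqI_real[OF P Q])
    show "\<bar>Re (f x)\<bar> \<le> 1" for x using bound(1)[of x] abs_Re_le_cmod[of "f x"] by linarith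
    show "\<bar>Re (g x)\<bar> \<le> 1" for x using bound(2)[of x] abs_Re_le_cmod[of "g x"] by linarith
    show "(CLINT x|P. of_real (Re (f x)) * iexp (t * X x)) = (CLINT x|Q. of_real (Re (g x)) * iexp (t * Y x))" for t
    proof -
      have "(CLINT x|P. of_real (Re (f x)) * iexp (t * X x))
        = (CLINT x|P. (f x * iexp (t * X x) + cnj (f x) * iexp (t * X x)) / 2)"
        by (intro Bochner_Integration.integral_cong HOL.refl) (simp only: re, simp add: field_simps)
      also have "\<dots> = ((CLINT x|P. f x * iexp (t * X x)) + (CLINT x|P. cnj (f x) * iexp (t * X x))) / 2"
        using int(1,3)[of t] by simp
      finally have P: "(CLINT x|P. of_real (Re (f x)) * iexp (t * X x))
        = ((CLINT x|P. f x * iexp (t * X x)) + (CLINT x|P. cnj (f x) * iexp (t * X x))) / 2" .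
      have "(CLINT x|Q. of_real (Re (g x)) * iexp (t * Y x))
        = (CLINT x|Q. (g x * iexp (t * Y x) + cnj (g x) * iexp (t * Y x)) / 2)"
        by (intro Bochner_Integration.integral_cong HOL.refl) (simp only: re, simp add: field_simps)
      also have "\<dots> = ((CLINT x|Q. g x * iexp (t * Y x)) + (CLINT x|Q. cnj (g x) * iexp (t * Y x))) / 2"
        using int'(1,3)[of t] by simp
      finally have Q: "(CLINT x|Q. of_real (Re (g x)) * iexp (t * Y x))
        = ((CLINT x|Q. g x * iexp (t * Y x)) + (CLINT x|Q. cnj (g x) * iexp (t * Y x))) / 2" .
      show ?thesis unfolding P Q wchar cw ..
    qed
  qed (use A char in auto)
  have 2: "(LINT x|P. Im (f x) * indicator A (X x)) = (LINT y|Q. Im (g y) * indicator A (Y y))"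
  proof (rule weighted_law_eqI_real[OF P Q])
    show "\<bar>Im (f x)\<bar> \<le> 1" for x using bound(1)[of x] abs_Im_le_cmod[of "f x"] by linarith
    show "\<bar>Im (g x)\<bar> \<le> 1" for x using bound(2)[of x] abs_Im_le_cmod[of "g x"] by linarith
    show "(CLINT x|P. of_real (Im (f x)) * iexp (t * X x)) = (CLINT x|Q. of_real (Im (g x)) * iexp (t * Y x))" for t
    proof -
      have "(CLINT x|P. of_real (Im (f x)) * iexp (t * X x))
        = (CLINT x|P. (f x * iexp (t * X x) - cnj (f x) * iexp (t * X x)) / (2 * \<i>))"
        by (intro Bochner_Integration.integral_cong HOL.refl) (simp only: im, simp add: field_simps)
      also have "\<dots> = ((CLINT x|P. f x * iexp (t * X x)) - (CLINT x|P. cnj (f x) * iexp (t * X x))) / (2 * \<i>)"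
        using int(1,3)[of t] by simp
      finally have P: "(CLINT x|P. of_real (Im (f x)) * iexp (t * X x))
        = ((CLINT x|P. f x * iexp (t * X x)) - (CLINT x|P. cnj (f x) * iexp (t * X x))) / (2 * \<i>)" .
      have "(CLINT x|Q. of_real (Im (g x)) * iexp (t * Y x))
        = (CLINT x|Q. (g x * iexp (t * Y x) - cnj (g x) * iexp (t * Y x)) / (2 * \<i>))"
        by (intro Bochner_Integration.integral_cong HOL.refl) (simp only: im, simp add: field_simps)
      also have "\<dots> = ((CLINT x|Q. g x * iexp (t * Y x)) - (CLINT x|Q. cnj (g x) * iexp (t * Y x))) / (2 * \<i>)"
        using int'(1,3)[of t] by simp
      finally have Q: "(CLINT x|Q. of_real (Im (g x)) * iexp (t * Y x))
        = ((CLINT x|Q. g x * iexp (t * Y x)) - (CLINT x|Q. cnj (g x) * iexp (t * Y x))) / (2 * \<i>)" .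
      show ?thesis unfolding P Q wchar cw ..
    qed
  qed (use A char in auto)
  have ind: "Re (indicator A y) = indicator A y" "Im (indicator A y) = 0" for y :: real
    by (auto split: split_indicator)
  show ?thesis
    using 1 2 int(2) int'(2) by (simp add: complex_eq_iff ind flip: integral_Re integral_Im)
qed

text \<open>The induction step trades one exponential factor for an indicator, by Levy's uniqueness theorem
  in the remaining coordinate; \<open>J = I\<close> gives the Cramer-Wold device.\<close>

lemma char_mixed_boxes:
  fixes X :: "'i \<Rightarrow> 'a \<Rightarrow> real" and Y :: "'i \<Rightarrow> 'b \<Rightarrow> real"
  assumes P: "prob_space P" and Q: "prob_space Q" and I: "finite I"
    and meas: "\<And>i. i \<in> I \<Longrightarrow> X i \<in> borel_measurable P" "\<And>i. i \<in> I \<Longrightarrow> Y i \<in> borel_measurable Q"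
    and char: "\<And>w. (CLINT x|P. iexp (\<Sum>i\<in>I. w i * X i x)) = (CLINT y|Q. iexp (\<Sum>i\<in>I. w i * Y i y))"
    and J: "J \<subseteq> I" and B: "\<And>i. i \<in> J \<Longrightarrow> B i \<in> sets borel"
  shows "(CLINT x|P. (\<Prod>i\<in>J. indicator (B i) (X i x)) * iexp (\<Sum>i\<in>I - J. w i * X i x))
    = (CLINT y|Q. (\<Prod>i\<in>J. indicator (B i) (Y i y)) * iexp (\<Sum>i\<in>I - J. w i * Y i y))"
proof -
  have "finite J" using I J finite_subset by blast
  then show ?thesis using J B
  proof (induction J arbitrary: w)
    case empty
    then show ?case using char by simp
  next
    case (insert j J)
    let ?K = "I - insert j J"
    have fin: "finite ?K" "j \<notin> ?K" using I by auto
    have split: "I - J = insert j ?K" using insert by auto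
    note [measurable] = meas
    let ?f = "\<lambda>x. (\<Prod>i\<in>J. indicator (B i) (X i x)) * iexp (\<Sum>i\<in>?K. w i * X i x) :: complex"
    let ?g = "\<lambda>x. (\<Prod>i\<in>J. indicator (B i) (Y i x)) * iexp (\<Sum>i\<in>?K. w i * Y i x) :: complex"
    have nrm: "norm (\<Prod>i\<in>J. indicator (B i) (h i) :: complex) \<le> 1" for h :: "'i \<Rightarrow> real"
      unfolding prod_norm[symmetric] by (intro prod_le_1) (auto split: split_indicator)
    have meas': "(\<lambda>x. indicator (B i) (X i x) :: complex) \<in> borel_measurable P"
      "(\<lambda>x. indicator (B i) (Y i x) :: complex) \<in> borel_measurable Q" if "i \<in> J" for i
    proof -
      have [measurable]: "X i \<in> borel_measurable P" "Y i \<in> borel_measurable Q" "B i \<in> sets borel"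
        using that insert.prems meas by auto
      show "(\<lambda>x. indicator (B i) (X i x) :: complex) \<in> borel_measurable P"
        "(\<lambda>x. indicator (B i) (Y i x) :: complex) \<in> borel_measurable Q"
        by measurable
    qed
    have "(CLINT x|P. ?f x * indicator (B j) (X j x)) = (CLINT x|Q. ?g x * indicator (B j) (Y j x))"
    proof (rule weighted_law_eqI[OF P Q])
      show "X j \<in> borel_measurable P" "Y j \<in> borel_measurable Q" using insert meas by auto
      show "?f \<in> borel_measurable P" "?g \<in> borel_measurable Q"
        using meas' meas by (auto intro!: borel_measurable_times borel_measurable_prod
          borel_measurable_exp borel_measurable_of_real borel_measurable_sum)
      show "norm (?f x) \<le> 1" for x using nrm[of "\<lambda>i. X i x"] by (simp add: norm_mult)
      show "norm (?g x) \<le> 1" for x using nrm[of "\<lambda>i. Y i x"] by (simp add: norm_mult)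
      show "B j \<in> sets borel" using insert by auto
      \<comment> \<open>A single coordinate is the frequency vector supported at
        \<open>j\<close>.\<close>
      show "(CLINT x|P. iexp (t * X j x)) = (CLINT y|Q. iexp (t * Y j y))" for t
      proof -
        have "(\<Sum>i\<in>I. (if i = j then t else 0) * h i) = t * h j" for h :: "'i \<Rightarrow> real"
          using I insert.prems by (simp add: if_distrib[of "\<lambda>u. u * _"] cong: if_cong)
        then show ?thesis using char[of "\<lambda>i. if i = j then t else 0"] by simp
      qed
      \<comment> \<open>The induction hypothesis is needed with the frequency of \<open>j\<close>
        replaced by \<open>t\<close>; this is why \<open>w\<close> is generalized.\<close>
      show "(CLINT x|P. ?f x * iexp (t * X j x)) = (CLINT x|Q. ?g x * iexp (t * Y j x))" for t
      proof -
        have "(\<Sum>i\<in>I - J. (w(j := t)) i * h i) = (\<Sum>i\<in>?K. w i * h i) + t * h j" for h :: "'i \<Rightarrow> real"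
        proof -
          have "(\<Sum>i\<in>?K. (w(j := t)) i * h i) = (\<Sum>i\<in>?K. w i * h i)" by (rule sum.cong) auto
          then show ?thesis unfolding split using fin by simp
        qed
        then show ?thesis using insert.IH[of "w(j := t)"] insert.prems
          by (simp add: exp_add ring_distribs mult.assoc)
      qed
    qed
    then show ?case using insert by (simp add: mult_ac)
  qed
qed

text \<open>A finite product measure space is generated by boxes, and the expectation of a product
  of indicators is the probability of a box.\<close>

lemma distr_PiM_eqI_char:
  fixes X :: "'i \<Rightarrow> 'a \<Rightarrow> real" and Y :: "'i \<Rightarrow> 'b \<Rightarrow> real"
  assumes P: "prob_space P" and Q: "prob_space Q" and I: "finite I"
    and meas: "\<And>i. i \<in> I \<Longrightarrow> X i \<in> borel_measurable P" "\<And>i. i \<in> I \<Longrightarrow> Y i \<in> borel_measurable Q"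
    and char: "\<And>w. (CLINT x|P. iexp (\<Sum>i\<in>I. w i * X i x)) = (CLINT y|Q. iexp (\<Sum>i\<in>I. w i * Y i y))"
  shows "distr P (\<Pi>\<^sub>M i\<in>I. borel) (\<lambda>x. \<lambda>i\<in>I. X i x) = distr Q (\<Pi>\<^sub>M i\<in>I. borel) (\<lambda>y. \<lambda>i\<in>I. Y i y)"
proof -
  interpret P: prob_space P by fact
  interpret Q: prob_space Q by fact
  have mX: "(\<lambda>x. \<lambda>i\<in>I. X i x) \<in> measurable P (\<Pi>\<^sub>M i\<in>I. borel)"
    and mY: "(\<lambda>x. \<lambda>i\<in>I. Y i x) \<in> measurable Q (\<Pi>\<^sub>M i\<in>I. borel)"
    using meas by (auto intro!: measurable_restrict)
  interpret X: prob_space "distr P (\<Pi>\<^sub>M i\<in>I. borel) (\<lambda>x. \<lambda>i\<in>I. X i x)" by (rule P.prob_space_distr[OF mX])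
  show ?thesis
  proof (rule measure_eqI_PiM_finite[OF I])
    fix B :: "'i \<Rightarrow> real set" assume B: "\<And>i. i \<in> I \<Longrightarrow> B i \<in> sets borel"
    then have box: "Pi\<^sub>E I B \<in> sets (\<Pi>\<^sub>M i\<in>I. borel)" by (auto intro!: sets_PiM_I_finite I)
    have ind: "(\<Prod>i\<in>I. indicator (B i) (h i)) = (indicator (Pi\<^sub>E I B) (\<lambda>i\<in>I. h i) :: complex)" for h
      using I by (cases "h \<in> Pi I B") (auto simp: Pi_iff indicator_def intro!: prod.neutral)
    have "complex_of_real (measure P ((\<lambda>x. \<lambda>i\<in>I. X i x) -` Pi\<^sub>E I B \<inter> space P))
      = (CLINT x|P. indicator (Pi\<^sub>E I B) (\<lambda>i\<in>I. X i x))"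
      using measurable_sets[OF mX box]
      by (subst Bochner_Integration.integral_cong[OF HOL.refl, of _ _ "\<lambda>x. complex_of_real (indicator ((\<lambda>x. \<lambda>i\<in>I. X i x) -` Pi\<^sub>E I B \<inter> space P) x)"])
         (auto split: split_indicator)
    also have "\<dots> = (CLINT x|Q. indicator (Pi\<^sub>E I B) (\<lambda>i\<in>I. Y i x))"
      using char_mixed_boxes[where P=P and Q=Q and X=X and Y=Y and I=I and J=I and B=B and w="\<lambda>_. 0",
        OF P Q I meas char subset_refl B]
      by (simp add: ind)
    also have "\<dots> = complex_of_real (measure Q ((\<lambda>x. \<lambda>i\<in>I. Y i x) -` Pi\<^sub>E I B \<inter> space Q))"
      using measurable_sets[OF mY box]
      by (subst Bochner_Integration.integral_cong[OF HOL.refl, of _ _ "\<lambda>x. complex_of_real (indicator ((\<lambda>x. \<lambda>i\<in>I. Y i x) -` Pi\<^sub>E I B \<inter> space Q) x)"])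
         (auto split: split_indicator)
    finally have "measure P ((\<lambda>x. \<lambda>i\<in>I. X i x) -` Pi\<^sub>E I B \<inter> space P)
      = measure Q ((\<lambda>x. \<lambda>i\<in>I. Y i x) -` Pi\<^sub>E I B \<inter> space Q)" by simp
    then show "emeasure (distr P (\<Pi>\<^sub>M i\<in>I. borel) (\<lambda>x. \<lambda>i\<in>I. X i x)) (Pi\<^sub>E I B)
      = emeasure (distr Q (\<Pi>\<^sub>M i\<in>I. borel) (\<lambda>y. \<lambda>i\<in>I. Y i y)) (Pi\<^sub>E I B)"
      using box mX mY by (simp add: emeasure_distr P.emeasure_eq_measure Q.emeasure_eq_measure)
  next
    show "range (\<lambda>_::nat. \<Pi>\<^sub>E i\<in>I. UNIV) \<subseteq> prod_algebra I (\<lambda>_. borel :: real measure)"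
      using I by (auto intro!: prod_algebraI_finite)
  qed (auto simp: space_PiM)
qed

section \<open>Power sums of eigenvalues\<close>

lemma proots_prod_linear:
  "proots (\<Prod>a\<leftarrow>as. [:- a, 1:]) = mset (as :: 'a :: idom list)"
proof (induction as)
  case (Cons a as)
  have "(\<Prod>a\<leftarrow>as. [:- a, 1:]) \<noteq> 0" by (auto simp: prod_list_zero_iff)
  then show ?case
    using Cons proots_mult[of "[:- a, 1:]" "\<Prod>a\<leftarrow>as. [:- a, 1:]"] proots_linear_factor[of "- a"]
    by (simp del: mult_pCons_left)
qed simp

lemma diag_sum_mult_commute:
  fixes X Y :: "'a :: comm_semiring_0 mat"
  assumes "X \<in> carrier_mat n n" "Y \<in> carrier_mat n n"
  shows "(\<Sum>i<n. (X * Y) $$ (i, i)) = (\<Sum>i<n. (Y * X) $$ (i, i))"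
proof -
  have "(\<Sum>i<n. (X * Y) $$ (i, i)) = (\<Sum>i<n. \<Sum>l<n. X $$ (i, l) * Y $$ (l, i))"
    using assms by (auto simp: scalar_prod_def lessThan_atLeast0)
  also have "\<dots> = (\<Sum>l<n. \<Sum>i<n. Y $$ (l, i) * X $$ (i, l))"
    by (subst sum.swap) (simp add: mult.commute)
  also have "\<dots> = (\<Sum>i<n. (Y * X) $$ (i, i))"
    using assms by (auto simp: scalar_prod_def lessThan_atLeast0)
  finally show ?thesis .
qed

lemma upper_triangular_pow:
  fixes T :: "'a :: comm_semiring_1 mat"
  assumes T: "T \<in> carrier_mat n n" and ut: "upper_triangular T"
  shows "(\<forall>i<n. \<forall>l<i. (T ^\<^sub>m j) $$ (i, l) = 0) \<and> (\<forall>i<n. (T ^\<^sub>m j) $$ (i, i) = T $$ (i, i) ^ j)"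
proof (induction j)
  case 0
  then show ?case using T by auto
next
  case (Suc j)
  have Tj: "T ^\<^sub>m j \<in> carrier_mat n n" using T by auto
  have mult: "(T ^\<^sub>m Suc j) $$ (i, l) = (\<Sum>u<n. (T ^\<^sub>m j) $$ (i, u) * T $$ (u, l))"
    if "i < n" "l < n" for i l
    using that T Tj by (auto simp: scalar_prod_def lessThan_atLeast0)
  have T0: "T $$ (u, l) = 0" if "l < u" "u < n" for u l using ut T that by (auto dest: upper_triangularD)
  show ?case
  proof (intro conjI allI impI)
    fix i l assume "i < n" "l < i"
    have "(T ^\<^sub>m j) $$ (i, u) * T $$ (u, l) = 0" if "u < n" for u
      using that Suc T0[of l u] \<open>i < n\<close> \<open>l < i\<close> by (cases "u < i") auto
    then show "(T ^\<^sub>m Suc j) $$ (i, l) = 0"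
      unfolding mult[OF \<open>i < n\<close> less_trans[OF \<open>l < i\<close> \<open>i < n\<close>]] by simp
  next
    fix i assume i: "i < n"
    have "(T ^\<^sub>m j) $$ (i, u) * T $$ (u, i) = (if u = i then T $$ (i, i) ^ Suc j else 0)" if "u < n" for u
      using that i Suc T0[of i u] by (cases u i rule: linorder_cases) (auto simp: mult.commute)
    then show "(T ^\<^sub>m Suc j) $$ (i, i) = T $$ (i, i) ^ Suc j"
      unfolding mult[OF i i] using i by simp
  qed
qed

text \<open>Schur triangularization: \<open>A ^\<^sub>m j\<close> is similar to
  \<open>T ^\<^sub>m j\<close>, the diagonal sum is invariant under similarity, and the diagonal of
  \<open>T ^\<^sub>m j\<close> consists of the powers of the roots.\<close>

lemma sum_proots_char_poly_power:
  fixes A :: "complex mat"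
  assumes A: "A \<in> carrier_mat n n"
  shows "(\<Sum>x\<in>#proots (char_poly A). x ^ j) = (\<Sum>i<n. (A ^\<^sub>m j) $$ (i, i))"
proof -
  obtain es where es: "char_poly A = (\<Prod>a\<leftarrow>es. [:- a, 1:])" using char_poly_factorized[OF A] by blast
  obtain T U V where schur: "schur_decomposition A es = (T, U, V)" by (cases "schur_decomposition A es") auto
  from schur_decomposition[OF A es schur]
  have wit: "similar_mat_wit A T U V" and ut: "upper_triangular T" and diag: "diag_mat T = es" by auto
  have c: "A ^\<^sub>m j \<in> carrier_mat n n" using A by auto
  note W = similar_mat_witD2[OF c similar_mat_wit_pow[OF wit, of j]]
  have T: "T \<in> carrier_mat n n" using similar_mat_witD2[OF A wit] by auto
  have "(\<Sum>i<n. (A ^\<^sub>m j) $$ (i, i)) = (\<Sum>i<n. ((U * T ^\<^sub>m j) * V) $$ (i, i))" using W(3) by simp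
  also have "\<dots> = (\<Sum>i<n. (V * (U * T ^\<^sub>m j)) $$ (i, i))"
    by (rule diag_sum_mult_commute) (use W T in auto)
  also have "V * (U * T ^\<^sub>m j) = T ^\<^sub>m j"
    using W T by (subst assoc_mult_mat[symmetric, of _ n n _ n _ n]) auto
  also have "(\<Sum>i<n. (T ^\<^sub>m j) $$ (i, i)) = (\<Sum>i<n. T $$ (i, i) ^ j)"
    using upper_triangular_pow[OF T ut, of j] by simp
  also have "\<dots> = (\<Sum>x\<leftarrow>diag_mat T. x ^ j)"
    using T by (simp add: diag_mat_def comp_def sum_list_sum_nth lessThan_atLeast0)
  also have "\<dots> = (\<Sum>x\<in>#proots (char_poly A). x ^ j)"
    unfolding es proots_prod_linear diag by (simp add: sum_mset_sum_list flip: mset_map)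
  finally show ?thesis ..
qed

section \<open>Hermitian matrices and their normalized spectra\<close>

definition hermitian_mat :: "nat \<Rightarrow> complex mat \<Rightarrow> bool" where
  "hermitian_mat n A \<longleftrightarrow> A \<in> carrier_mat n n \<and> (\<forall>i<n. \<forall>j<n. A $$ (i, j) = cnj (A $$ (j, i)))"

text \<open>For an eigenvector \<open>v\<close>, the quadratic form of \<open>A\<close> at
  \<open>v\<close> is \<open>x * q\<close>, where \<open>q\<close> is the squared norm of
  \<open>v\<close>. The form is its own conjugate and \<open>q\<close> is real and nonzero.\<close>

lemma hermitian_mat_root_real:
  assumes A: "hermitian_mat n A" and x: "x \<in># proots (char_poly A)"
  shows "of_real (Re x) = x"
proof -
  have c: "A \<in> carrier_mat n n" and h: "\<And>i j. i < n \<Longrightarrow> j < n \<Longrightarrow> cnj (A $$ (i, j)) = A $$ (j, i)"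
    using A unfolding hermitian_mat_def by (blast, metis)
  have "char_poly A \<noteq> 0" using degree_monic_char_poly[OF c] by auto
  then have "eigenvalue A x" using x by (simp add: eigenvalue_root_char_poly[OF c] set_count_proots)
  then obtain v where v: "v \<in> carrier_vec n" "v \<noteq> 0\<^sub>v n" and Av: "A *\<^sub>v v = x \<cdot>\<^sub>v v"
    using c by (auto simp: eigenvalue_def eigenvector_def)
  define q where "q = (\<Sum>i<n. cnj (v $ i) * v $ i)"
  have row: "(\<Sum>j<n. A $$ (i, j) * v $ j) = x * v $ i" if i: "i < n" for i
  proof -
    have "(A *\<^sub>v v) $ i = (\<Sum>j<n. A $$ (i, j) * v $ j)"
      using i c v by (auto simp: scalar_prod_def lessThan_atLeast0)
    then show ?thesis using Av i v by simp
  qed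
  have "x * q = (\<Sum>i<n. cnj (v $ i) * (\<Sum>j<n. A $$ (i, j) * v $ j))"
    using row by (simp add: q_def sum_distrib_left mult_ac)
  also have "\<dots> = (\<Sum>i<n. \<Sum>j<n. cnj (v $ i) * A $$ (i, j) * v $ j)" by (simp add: sum_distrib_left mult.assoc)
  also have "\<dots> = (\<Sum>j<n. \<Sum>i<n. cnj (v $ i) * A $$ (i, j) * v $ j)" by (rule sum.swap)
  also have "\<dots> = cnj (\<Sum>j<n. cnj (v $ j) * (\<Sum>i<n. A $$ (j, i) * v $ i))"
    using h by (simp add: sum_distrib_left mult_ac)
  also have "\<dots> = cnj x * cnj q" using row by (simp add: q_def sum_distrib_left mult_ac)
  also have "cnj q = q" by (simp add: q_def mult.commute)
  finally have eq: "x * q = cnj x * q" .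
  obtain i where i: "i < n" "v $ i \<noteq> 0" using v by (metis eq_vecI carrier_vecD index_zero_vec)
  have "q = of_real (\<Sum>i<n. (cmod (v $ i))\<^sup>2)"
    by (simp add: q_def complex_norm_square mult.commute del: of_real_power)
  moreover have "(\<Sum>i<n. (cmod (v $ i))\<^sup>2) > 0"
    using i by (intro sum_pos2[of _ i]) auto
  ultimately have "q \<noteq> 0" by (metis of_real_eq_0_iff less_irrefl)
  then have "x = cnj x" using eq by simp
  then show ?thesis by (simp add: complex_eq_iff)
qed

text \<open>A multiset rather than a measure, so that the spectrum of the large matrix can be
  written as a sum over its blocks.\<close>

definition spectrum_mset :: "nat \<Rightarrow> complex mat \<Rightarrow> real multiset" where
  "spectrum_mset n A = image_mset (\<lambda>x. Re x / sqrt (real n)) (proots (char_poly A))"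

lemma of_real_sum_mset:
  "(\<Sum>x\<in>#R. complex_of_real (f x)) = of_real (\<Sum>x\<in>#R. f x)"
  by (induction R) auto

text \<open>\<open>Re\<close> commutes with powers here because the roots are real.\<close>

lemma sum_spectrum_mset_power:
  assumes A: "hermitian_mat n A"
  shows "(\<Sum>y\<in>#spectrum_mset n A. y ^ j) = Re (\<Sum>i<n. (A ^\<^sub>m j) $$ (i, i)) / sqrt (real n) ^ j"
proof -
  have "Re (\<Sum>i<n. (A ^\<^sub>m j) $$ (i, i)) = Re (\<Sum>x\<in>#proots (char_poly A). x ^ j)"
    using A unfolding hermitian_mat_def by (subst sum_proots_char_poly_power) blast+
  also have "(\<Sum>x\<in>#proots (char_poly A). x ^ j) = (\<Sum>x\<in>#proots (char_poly A). complex_of_real (Re x ^ j))"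
    using hermitian_mat_root_real[OF A] by (intro arg_cong[of _ _ sum_mset] image_mset_cong) (simp add: of_real_power)
  also have "\<dots> = of_real (\<Sum>x\<in>#proots (char_poly A). Re x ^ j)"
    by (rule of_real_sum_mset)
  finally have "Re (\<Sum>i<n. (A ^\<^sub>m j) $$ (i, i)) = (\<Sum>x\<in>#proots (char_poly A). Re x ^ j)"
    by (simp only: Re_complex_of_real)
  then show ?thesis
    by (simp add: spectrum_mset_def multiset.map_comp comp_def power_mult_distrib power_inverse sum_mset_distrib_right divide_inverse)
qed

lemma sum_mset_poly_eqI:
  fixes R S :: "real multiset"
  assumes "\<And>j. (\<Sum>x\<in>#R. x ^ j) = (\<Sum>x\<in>#S. x ^ j)"
  shows "(\<Sum>x\<in>#R. poly p x) = (\<Sum>x\<in>#S. poly p x)"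
proof -
  have "(\<Sum>x\<in>#R. poly p x) = (\<Sum>i\<le>degree p. coeff p i * (\<Sum>x\<in>#R. x ^ i))" for R :: "real multiset"
    by (induction R) (simp_all add: poly_altdef ring_distribs sum.distrib)
  then show ?thesis by (simp only: assms)
qed

text \<open>Power sums determine all sums of polynomial values. The polynomial \<open>p\<close>
  below vanishes at every element of either multiset other than \<open>a\<close> but not at
  \<open>a\<close>, so it isolates the multiplicity of \<open>a\<close>.\<close>

lemma multiset_eqI_power_sums:
  fixes R S :: "real multiset"
  assumes "\<And>j. (\<Sum>x\<in>#R. x ^ j) = (\<Sum>x\<in>#S. x ^ j)"
  shows "R = S"
proof (rule multiset_eqI)
  fix a
  define Z where "Z = (set_mset R \<union> set_mset S) - {a}"
  define p where "p = (\<Prod>b\<in>Z. [:- b, 1:])"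
  have fin: "finite Z" by (simp add: Z_def)
  have p: "poly p x = (if x = a then poly p a else 0)" if "x \<in># R + S" for x
    using that fin by (auto simp: p_def poly_prod Z_def)
  have pa: "poly p a \<noteq> 0" using fin by (auto simp: p_def poly_prod Z_def)
  have "(\<Sum>x\<in>#T. poly p x) = poly p a * count T a" if "T = R \<or> T = S" for T
  proof -
    have "(\<Sum>x\<in>#T. poly p x) = (\<Sum>x\<in>#T. if x = a then poly p a else 0)"
      using p that by (intro arg_cong[of _ _ sum_mset] image_mset_cong) auto
    then show ?thesis by (simp add: sum_mset_delta)
  qed
  from this[of R] this[of S] show "count R a = count S a"
    using sum_mset_poly_eqI[OF assms, of p] pa by simp
qed

section \<open>Measurability of the spectral law\<close>

text \<open>The kernel inside \<open>eigenvalue_distribution\<close>; computing with the bind there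
  requires this kernel to be measurable in the sample.\<close>

definition spectral_law :: "nat \<Rightarrow> complex mat \<Rightarrow> real measure" where
  "spectral_law n A = distr (measure_pmf (pmf_of_multiset (proots (char_poly A)))) borel
     (\<lambda>x. Re x / sqrt (real n))"

lemma prob_space_spectral_law: "prob_space (spectral_law n A)"
  unfolding spectral_law_def by (rule measure_pmf.prob_space_distr) simp

lemma sets_spectral_law [simp]: "sets (spectral_law n A) = sets borel"
  by (simp add: spectral_law_def)

lemma sum_mset_eq_sum_count:
  fixes f :: "'b \<Rightarrow> real"
  shows "(\<Sum>x\<in>#R. f x) = (\<Sum>x\<in>set_mset R. real (count R x) * f x)"
proof (induction R)
  case (add a R)
  have "(\<Sum>x\<in>set_mset (add_mset a R). real (count (add_mset a R) x) * f x)
    = (\<Sum>x\<in>insert a (set_mset R). real (count R x) * f x + (if x = a then f x else 0))"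
    by (intro sum.cong) (auto simp: algebra_simps)
  also have "\<dots> = (\<Sum>x\<in>set_mset R. real (count R x) * f x) + f a"
    by (subst sum.distrib) (cases "a \<in># R"; simp add: insert_absorb not_in_iff)
  finally show ?case using add by simp
qed simp

lemma emeasure_spectral_law:
  assumes n: "n > 0" and A: "A \<in> carrier_mat n n" and S: "S \<in> sets borel"
  shows "emeasure (spectral_law n A) S = ennreal ((\<Sum>y\<in>#spectrum_mset n A. indicator S y) / n)"
proof -
  define R where "R = proots (char_poly A)"
  define T where "T = (\<lambda>x. Re x / sqrt (real n)) -` S"
  have size: "size R = n" using degree_monic_char_poly[OF A] by (simp add: R_def size_proots_complex)
  \<comment> \<open>\<open>pmf_of_multiset\<close> is a uniform draw only on a nonempty multiset;
    this is where \<open>n > 0\<close> enters.\<close>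
  with n have ne: "R \<noteq> {#}" by auto
  have "emeasure (spectral_law n A) S = emeasure (measure_pmf (pmf_of_multiset R)) T"
    using S by (simp add: spectral_law_def emeasure_distr R_def T_def)
  also have "\<dots> = ennreal (measure_pmf.prob (pmf_of_multiset R) T)"
    by (simp add: measure_pmf.emeasure_eq_measure)
  also have "measure_pmf.prob (pmf_of_multiset R) T
      = (LINT x|measure_pmf (pmf_of_multiset R). indicator T x)" by simp
  also have "\<dots> = (\<Sum>x\<in>set_mset R. pmf (pmf_of_multiset R) x * indicator T x)"
    using ne by (subst integral_measure_pmf[of "set_mset R"]) (auto simp: set_pmf_iff count_eq_zero_iff)
  also have "\<dots> = (\<Sum>x\<in>set_mset R. real (count R x) * indicator T x) / n"
    unfolding sum_divide_distrib by (rule sum.cong) (use ne size in auto)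
  also have "(\<Sum>x\<in>set_mset R. real (count R x) * indicator T x) = (\<Sum>x\<in>#R. indicator T x)"
    by (rule sum_mset_eq_sum_count[symmetric])
  also have "\<dots> = (\<Sum>y\<in>#spectrum_mset n A. indicator S y)"
    by (simp add: spectrum_mset_def R_def T_def multiset.map_comp comp_def indicator_vimage)
  finally show ?thesis .
qed

lemma tendsto_sum_mset:
  fixes f :: "nat \<Rightarrow> 'b \<Rightarrow> real"
  assumes "\<And>x. x \<in># R \<Longrightarrow> (\<lambda>i. f i x) \<longlonglongrightarrow> g x"
  shows "(\<lambda>i. \<Sum>x\<in>#R. f i x) \<longlonglongrightarrow> (\<Sum>x\<in>#R. g x)"
  using assms by (induction R) (auto intro!: tendsto_add)

text \<open>Collects what the measurability argument uses, so that it serves both ensembles, the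
  Fourier blocks, and the matrices rebuilt from coordinates on a product space.\<close>

locale hermitian_random_matrix =
  fixes n :: nat and P :: "'a measure" and M :: "'a \<Rightarrow> complex mat"
  assumes pos: "n > 0"
    and herm: "\<And>\<omega>. \<omega> \<in> space P \<Longrightarrow> hermitian_mat n (M \<omega>)"
    and entry_measurable: "\<And>i j. i < n \<Longrightarrow> j < n \<Longrightarrow> (\<lambda>\<omega>. M \<omega> $$ (i, j)) \<in> borel_measurable P"
begin

lemma carrier: "\<omega> \<in> space P \<Longrightarrow> M \<omega> \<in> carrier_mat n n"
  using herm unfolding hermitian_mat_def by blast

lemma pow_entry_measurable:
  assumes "i < n" "l < n"
  shows "(\<lambda>\<omega>. (M \<omega> ^\<^sub>m j) $$ (i, l)) \<in> borel_measurable P"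
  using assms
proof (induction j arbitrary: l)
  case 0
  have "(M \<omega> ^\<^sub>m 0) $$ (i, l) = (if i = l then 1 else 0)" if "\<omega> \<in> space P" for \<omega>
    using 0 carrier[OF that] by auto
  then show ?case by (subst measurable_cong) (assumption, simp)
next
  case (Suc j)
  have eq: "(M \<omega> ^\<^sub>m Suc j) $$ (i, l) = (\<Sum>u<n. (M \<omega> ^\<^sub>m j) $$ (i, u) * M \<omega> $$ (u, l))" if "\<omega> \<in> space P" for \<omega>
    using Suc.prems carrier[OF that] by (auto simp: scalar_prod_def lessThan_atLeast0)
  have "(\<lambda>\<omega>. \<Sum>u<n. (M \<omega> ^\<^sub>m j) $$ (i, u) * M \<omega> $$ (u, l)) \<in> borel_measurable P"
    using Suc entry_measurable by (intro borel_measurable_sum borel_measurable_times) auto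
  then show ?case using eq by (subst measurable_cong) auto
qed

text \<open>Power sums of eigenvalues are traces of matrix powers, hence polynomials in the
  measurable entries.\<close>

lemma poly_sum_measurable:
  "(\<lambda>\<omega>. \<Sum>y\<in>#spectrum_mset n (M \<omega>). (\<Sum>i\<le>d. a i * y ^ i)) \<in> borel_measurable P"
proof -
  have "(\<Sum>y\<in>#spectrum_mset n (M \<omega>). (\<Sum>i\<le>d. a i * y ^ i))
    = (\<Sum>i\<le>d. a i * (Re (\<Sum>l<n. (M \<omega> ^\<^sub>m i) $$ (l, l)) / sqrt (real n) ^ i))" if "\<omega> \<in> space P" for \<omega>
  proof -
    have "(\<Sum>y\<in>#R. (\<Sum>i\<le>d. a i * y ^ i)) = (\<Sum>i\<le>d. a i * (\<Sum>y\<in>#R. y ^ i))" for R :: "real multiset"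
      by (induction R) (simp_all add: ring_distribs sum.distrib)
    then show ?thesis by (simp only: sum_spectrum_mset_power[OF herm[OF that]])
  qed
  then show ?thesis using pow_entry_measurable
    by (subst measurable_cong) (auto intro!: borel_measurable_sum borel_measurable_times
      borel_measurable_divide measurable_compose[OF _ borel_measurable_Re])
qed

text \<open>Stone-Weierstrass approximates \<open>g\<close> on growing intervals. The convergence is
  only pointwise on the line, which suffices because each spectrum is finite.\<close>

lemma continuous_sum_measurable:
  fixes g :: "real \<Rightarrow> real"
  assumes "continuous_on UNIV g"
  shows "(\<lambda>\<omega>. \<Sum>y\<in>#spectrum_mset n (M \<omega>). g y) \<in> borel_measurable P"
proof -
  have "\<exists>p. real_polynomial_function p \<and> (\<forall>x\<in>{-real m..real m}. \<bar>g x - p x\<bar> < 1 / real (Suc m))" for m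
    by (rule Stone_Weierstrass_real_polynomial_function[of "{-real m..real m}" g "1 / real (Suc m)"])
       (use assms continuous_on_subset in auto)
  then obtain p where p: "\<And>m. real_polynomial_function (p m)"
    "\<And>m x. x \<in> {-real m..real m} \<Longrightarrow> \<bar>g x - p m x\<bar> < 1 / real (Suc m)" by metis
  have meas: "(\<lambda>\<omega>. \<Sum>y\<in>#spectrum_mset n (M \<omega>). p m y) \<in> borel_measurable P" for m
    using real_polynomial_function_imp_sum[OF p(1)[of m]] poly_sum_measurable by auto
  have lim: "(\<lambda>m. p m x) \<longlonglongrightarrow> g x" for x
  proof (rule LIM_zero_cancel, rule Lim_null_comparison)
    show "\<forall>\<^sub>F m in sequentially. norm (p m x - g x) \<le> 1 / real (Suc m)"
    proof (rule eventually_sequentiallyI)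
      fix m assume m: "m \<ge> nat \<lceil>\<bar>x\<bar>\<rceil>"
      then have "\<bar>x\<bar> \<le> real m" by linarith
      then show "norm (p m x - g x) \<le> 1 / real (Suc m)" using p(2)[of x m] by (auto simp: abs_le_iff abs_minus_commute)
    qed
    show "(\<lambda>m. 1 / real (Suc m)) \<longlonglongrightarrow> 0" using LIMSEQ_inverse_real_of_nat by (simp add: inverse_eq_divide)
  qed
  show ?thesis
    by (rule borel_measurable_LIMSEQ_real[of P "\<lambda>m \<omega>. \<Sum>y\<in>#spectrum_mset n (M \<omega>). p m y"])
       (auto intro!: tendsto_sum_mset lim meas)
qed

lemma atMost_sum_measurable:
  "(\<lambda>\<omega>. \<Sum>y\<in>#spectrum_mset n (M \<omega>). indicator {..a} y :: real) \<in> borel_measurable P"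
proof -
  \<comment> \<open>For \<open>m > 0\<close> this is 1 up to \<open>a\<close> and falls linearly to
    0 on \<open>[a, a + 1/m]\<close>: a continuous approximation of the indicator of the
    half-line.\<close>
  define g where "g m y = max 0 (1 - real m * max 0 (y - a))" for m and y :: real
  have lim: "(\<lambda>m. g m y) \<longlonglongrightarrow> indicator {..a} y" for y
  proof (cases "y \<le> a")
    case True
    then show ?thesis by (simp add: g_def)
  next
    case False
    then have d: "y - a > 0" by simp
    have "\<forall>\<^sub>F m in sequentially. g m y = 0"
    proof (rule eventually_sequentiallyI)
      fix m assume "m \<ge> nat \<lceil>1 / (y - a)\<rceil>"
      then have "1 / (y - a) \<le> real m" by linarith
      then have "1 \<le> real m * (y - a)" using d by (simp add: field_simps)
      then show "g m y = 0" using d by (simp add: g_def)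
    qed
    then show ?thesis using False by (simp add: tendsto_eventually)
  qed
  have cont: "continuous_on UNIV (g m)" for m
    unfolding g_def by (intro continuous_intros)
  show ?thesis
  proof (rule borel_measurable_LIMSEQ_real)
    show "(\<lambda>m. \<Sum>y\<in>#spectrum_mset n (M \<omega>). g m y)
        \<longlonglongrightarrow> (\<Sum>y\<in>#spectrum_mset n (M \<omega>). indicator {..a} y)" for \<omega>
      by (intro tendsto_sum_mset lim)
    show "(\<lambda>\<omega>. \<Sum>y\<in>#spectrum_mset n (M \<omega>). g m y) \<in> borel_measurable P" for m
      by (intro continuous_sum_measurable cont)
  qed
qed

text \<open>Half-lines are an intersection-stable generator of the Borel sets, so the masses of
  half-lines decide.\<close>

lemma spectral_law_measurable: "(\<lambda>\<omega>. spectral_law n (M \<omega>)) \<in> P \<rightarrow>\<^sub>M subprob_algebra borel"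
proof (rule measurable_subprob_algebra_generated[where \<Omega>=UNIV and G="range (\<lambda>a::real. {..a})"])
  show "sets borel = sigma_sets UNIV (range (\<lambda>a::real. {..a}))"
    by (subst borel_eq_atMost) simp
  show "Int_stable (range (\<lambda>a::real. {..a}))" by (auto simp: Int_stable_def)
  show "subprob_space (spectral_law n (M \<omega>))" for \<omega>
    by (intro prob_space_imp_subprob_space prob_space_spectral_law)
  fix B assume "B \<in> range (\<lambda>a::real. {..a})"
  then obtain a where B: "B = {..a}" by blast
  show "(\<lambda>\<omega>. emeasure (spectral_law n (M \<omega>)) B) \<in> borel_measurable P"
    unfolding B using atMost_sum_measurable[of a] pos carrier
    by (subst measurable_cong[OF emeasure_spectral_law]) auto
next
  have "emeasure (spectral_law n (M \<omega>)) UNIV = 1" for \<omega>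
    using prob_space.emeasure_space_1[OF prob_space_spectral_law, of n "M \<omega>"]
    by (simp add: spectral_law_def)
  then show "(\<lambda>\<omega>. emeasure (spectral_law n (M \<omega>)) UNIV) \<in> borel_measurable P" by simp
qed auto

lemma emeasure_eigenvalue_distribution:
  assumes P: "prob_space P" and S: "S \<in> sets borel"
  shows "emeasure (eigenvalue_distribution n P M) S = (\<integral>\<^sup>+\<omega>. emeasure (spectral_law n (M \<omega>)) S \<partial>P)"
proof -
  interpret prob_space P by fact
  show ?thesis
    unfolding eigenvalue_distribution_def spectral_law_def[symmetric]
    by (rule emeasure_bind[OF not_empty spectral_law_measurable S])
qed

lemma sets_eigenvalue_distribution:
  assumes P: "prob_space P"
  shows "sets (eigenvalue_distribution n P M) = sets borel"
proof -
  interpret prob_space P by fact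
  show ?thesis
    unfolding eigenvalue_distribution_def spectral_law_def[symmetric]
    by (rule sets_bind[OF _ not_empty]) simp
qed

end

section \<open>Chains of links\<close>

text \<open>The Boolean argument records whether the chain contains an even number of transpositions.\<close>

inductive parity_linked ::
    "nat \<Rightarrow> (int \<times> int \<Rightarrow> int) \<Rightarrow> nat \<Rightarrow> bool \<Rightarrow> nat \<times> nat \<Rightarrow> nat \<times> nat \<Rightarrow> bool"
  for k f N where
  start: "p \<in> {0..<N} \<times> {0..<N} \<Longrightarrow> parity_linked k f N True p p"
| transpose: "parity_linked k f N b p (l, j) \<Longrightarrow> parity_linked k f N (\<not> b) p (j, l)"
| step: "parity_linked k f N b p q \<Longrightarrow> r \<in> {0..<N} \<times> {0..<N} \<Longrightarrow> same_entry k f N q r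
    \<Longrightarrow> parity_linked k f N b p r"

lemma linked_iff_parity_linked: "linked k f N p q \<longleftrightarrow> (\<exists>b. parity_linked k f N b p q)"
proof
  show "\<exists>b. parity_linked k f N b p q" if "linked k f N p q"
    using that
  proof induction
    case (refl p)
    then show ?case by (blast intro: parity_linked.start)
  next
    case (conj p l j)
    then show ?case by (blast intro: parity_linked.transpose)
  next
    case (same p q r)
    then show ?case by (blast intro: parity_linked.step)
  qed
  have "linked k f N p q" if "parity_linked k f N b p q" for b
    using that
  proof induction
    case (start p)
    then show ?case by (rule linked.refl)
  next
    case (transpose b p l j)
    then show ?case by (blast intro: linked.conj)
  next
    case (step b p q r)
    then show ?case by (blast intro: linked.same)
  qed
  then show "linked k f N p q" if "\<exists>b. parity_linked k f N b p q"
    using that by blast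
qed

lemma parity_linked_grid:
  assumes "parity_linked k f N b p q"
  shows "p \<in> {0..<N} \<times> {0..<N} \<and> q \<in> {0..<N} \<times> {0..<N}"
  using assms by induction auto

text \<open>With \<open>True\<close> standing for even, \<open>b = b'\<close> is the parity of the
  concatenated chain.\<close>

lemma parity_linked_trans:
  assumes "parity_linked k f N b p q" "parity_linked k f N b' q r"
  shows "parity_linked k f N (b = b') p r"
  using assms(2,1)
proof induction
  case (transpose b' q l j)
  then show ?case using parity_linked.transpose[of k f N "b = b'" p l j] by (cases b') auto
next
  case (step b' p' q r)
  show ?case by (rule parity_linked.step[OF step.IH[OF step.prems] step.hyps(2,3)])
qed simp

lemma parity_linked_sym:
  assumes "parity_linked k f N b p q"
  shows "parity_linked k f N b q p"
  using assms
proof induction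
  case (transpose b p l j)
  then have "parity_linked k f N (\<not> True) (j, l) (l, j)"
    by (intro parity_linked.transpose parity_linked.start) (auto dest: parity_linked_grid)
  from parity_linked_trans[OF this transpose.IH] show ?case by simp
next
  case (step b p q r)
  have "parity_linked k f N True r q"
    by (rule parity_linked.step[OF parity_linked.start])
       (use step parity_linked_grid in \<open>auto simp: same_entry_def cong_sym_eq split: prod.splits\<close>)
  from parity_linked_trans[OF this step.IH] show ?case by simp
qed (rule parity_linked.start)

text \<open>\<open>link_at\<close> sees only residues modulo \<open>k\<close>, and a congruence
  modulo \<open>N\<close> implies one modulo \<open>k\<close>, so each move survives reduction. The
  second conjunct is the invariant that reduction loses: the index difference modulo
  \<open>N\<close> is kept by a step and negated by a transposition.\<close>

lemma parity_linked_project: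
  assumes "parity_linked k f N b p q" "k dvd N" "k > 0"
  shows "parity_linked k f k b (fst p mod k, snd p mod k) (fst q mod k, snd q mod k)
    \<and> [int (fst q) - int (snd q) = (if b then 1 else -1) * (int (fst p) - int (snd p))] (mod int N)"
  using assms(1)
proof induction
  case (start p)
  then show ?case using \<open>k > 0\<close> by (auto intro!: parity_linked.start)
next
  case (transpose b p l j)
  then have "[- (int l - int j) = - ((if b then 1 else -1) * (int (fst p) - int (snd p)))] (mod int N)"
    by (subst cong_minus_minus_iff) simp
  then show ?case using transpose parity_linked.transpose[of k f k b _ "l mod k" "j mod k"]
    by (auto split: if_splits)
next
  case (step b p q r)
  from step have se: "[int (fst q) - int (snd q) = int (fst r) - int (snd r)] (mod int N)"
      "link_at k f (fst q) (snd q) = link_at k f (fst r) (snd r)"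
    by (auto simp: same_entry_def split: prod.splits)
  have "[int (fst q) - int (snd q) = int (fst r) - int (snd r)] (mod int k)"
    using se(1) \<open>k dvd N\<close> by (meson cong_dvd_modulus of_nat_dvd_iff)
  then have "[int (fst q mod k) - int (snd q mod k) = int (fst r mod k) - int (snd r mod k)] (mod int k)"
    by (simp add: cong_def zmod_int mod_diff_eq)
  then have "same_entry k f k (fst q mod k, snd q mod k) (fst r mod k, snd r mod k)"
    using se(2) by (simp add: same_entry_def link_at_def zmod_int)
  then show ?case using step se(1) \<open>k > 0\<close>
    by (auto intro: parity_linked.step cong_trans cong_sym)
qed

text \<open>The chain modulo \<open>k\<close> is followed from its far end, with the target
  \<open>Q\<close> generalized. At a step the intermediate position is lifted to a point with the
  same index difference as \<open>Q\<close>; at a transposition the target is transposed.\<close>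

lemma parity_linked_lift:
  assumes "parity_linked k f k b p q" and k: "k dvd N" "k > 0" "N > 0"
    and P: "P \<in> {0..<N} \<times> {0..<N}" "p = (fst P mod k, snd P mod k)"
  shows "Q \<in> {0..<N} \<times> {0..<N} \<Longrightarrow> q = (fst Q mod k, snd Q mod k) \<Longrightarrow>
    [int (fst Q) - int (snd Q) = (if b then 1 else -1) * (int (fst P) - int (snd P))] (mod int N)
    \<Longrightarrow> parity_linked k f N b P Q"
  using assms(1) P(2)
proof (induction arbitrary: Q)
  case (start p)
  \<comment> \<open>Two lifts of one position with equal differences modulo \<open>N\<close> need
    not coincide, but they carry equal entries.\<close>
  have "same_entry k f N P Q"
    using start by (auto simp: same_entry_def link_at_def cong_sym_eq zmod_int[symmetric] split: prod.splits)
  then show ?case using start P by (auto intro: parity_linked.step parity_linked.start)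
next
  case (transpose b p l j)
  have c: "[- (int (fst Q) - int (snd Q)) = - ((if \<not> b then 1 else -1) * (int (fst P) - int (snd P)))] (mod int N)"
    using transpose.prems by (subst cong_minus_minus_iff) simp
  have "parity_linked k f N b P (snd Q, fst Q)"
    by (rule transpose.IH) (use transpose.prems c in \<open>auto split: if_splits\<close>)
  then show ?case using parity_linked.transpose[of k f N b P "snd Q" "fst Q"] by simp
next
  case (step b p q r)
  define d where "d = int (fst Q) - int (snd Q)"
  obtain l j where q: "q = (l, j)" "l < k" "j < k"
    using parity_linked_grid[OF step.hyps(1)] by (cases q) auto
  have kN: "k \<le> N" using k by (simp add: dvd_imp_le)
  \<comment> \<open>The lift of \<open>q\<close> keeps its row \<open>l\<close> and takes the column
    that makes the difference equal to \<open>d\<close> modulo \<open>N\<close>. It lies over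
    \<open>j\<close> because \<open>l - j\<close> and \<open>d\<close> agree modulo
    \<open>k\<close>.\<close>
  define j' where "j' = nat ((int l - d) mod int N)"
  have j': "int j' = (int l - d) mod int N" "j' < N"
    using \<open>N > 0\<close> by (auto simp: j'_def nat_less_iff)
  have "same_entry k f k q r" by (rule step.hyps)
  then have se: "[int l - int j = int (fst Q mod k) - int (snd Q mod k)] (mod int k)"
      "link_at k f l j = link_at k f (fst Q mod k) (snd Q mod k)"
    using step.prems q by (auto simp: same_entry_def)
  have "[int l - int j = d] (mod int k)"
    using se(1) unfolding d_def by (simp add: cong_def zmod_int mod_diff_eq)
  then have "[int j = int l - d] (mod int k)"
    using dvd_minus_iff[of "int k" "int l - int j - d"] by (simp add: cong_iff_dvd_diff algebra_simps)
  then have jk: "j' mod k = j"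
  proof -
    have "int (j' mod k) = (int l - d) mod int k"
      using k by (simp add: zmod_int j' mod_mod_cancel)
    also have "\<dots> = int j mod int k" using \<open>[int j = int l - d] (mod int k)\<close> by (simp add: cong_def)
    finally show ?thesis using q by simp
  qed
  have diff: "[int l - int j' = d] (mod int N)"
    unfolding j' by (simp add: cong_def mod_diff_right_eq)
  have "parity_linked k f N b P (l, j')"
    by (rule step.IH) (use q j' jk kN diff step.prems in \<open>auto simp: d_def intro: cong_trans\<close>)
  moreover have "same_entry k f N (l, j') Q"
    using diff se(2) q jk by (auto simp: same_entry_def link_at_def d_def zmod_int[symmetric] split: prod.splits)
  ultimately show ?case using step.prems by (auto intro: parity_linked.step)
qed

text \<open>Projection and lifting together; this transfers the covariances between the two
  sizes.\<close>

lemma parity_linked_iff: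
  assumes "k dvd N" "k > 0" "N > 0"
    and "l < N" "j < N" "m < N" "n < N"
  shows "parity_linked k f N True (l, j) (m, n) \<longleftrightarrow>
    parity_linked k f k True (l mod k, j mod k) (m mod k, n mod k) \<and> [int m - int n = int l - int j] (mod int N)"
proof (intro iffI conjI)
  assume "parity_linked k f N True (l, j) (m, n)"
  note * = parity_linked_project[OF this assms(1,2)]
  show "parity_linked k f k True (l mod k, j mod k) (m mod k, n mod k)" using * by simp
  show "[int m - int n = int l - int j] (mod int N)" using * by (simp only: if_True fst_conv snd_conv mult_1_left)
next
  assume *: "parity_linked k f k True (l mod k, j mod k) (m mod k, n mod k) \<and> [int m - int n = int l - int j] (mod int N)"
  show "parity_linked k f N True (l, j) (m, n)"
    by (rule parity_linked_lift[OF conjunct1[OF *] assms(1-3)])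
      (use assms(4-7) * in \<open>simp_all only: if_True fst_conv snd_conv mult_1_left mem_Times_iff atLeastLessThan_iff le0 simp_thms\<close>)
qed

section \<open>Gaussian entries\<close>

lemma real_gaussian_facts:
  shows "prob_space real_gaussian" "sets real_gaussian = sets borel"
    "integrable real_gaussian (\<lambda>x. x)" "integrable real_gaussian (\<lambda>x. x\<^sup>2)"
    "(LINT x|real_gaussian. x) = 0" "(LINT x|real_gaussian. x\<^sup>2) = 1"
    "char real_gaussian t = of_real (exp (- t\<^sup>2 / 2))"
  using real_dist_normal_dist integrable_std_normal_distribution_moment[of 1]
    integrable_std_normal_distribution_moment[of 2] integral_std_normal_distribution_moment_odd[of 1]
    std_normal_distribution_even_moments(1)[of 1] char_std_normal_distribution
  by (auto simp: real_gaussian_def real_distribution_def)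

lemma char_cmult: "(CLINT x|M. iexp (a * x)) = char M a"
  by (simp add: char_def)

text \<open>The last clause writes the characteristic function through the second moment of the same
  linear functional, a form shared with the complex Gaussian and stable under independent
  sums.\<close>

lemma real_gaussian_of_real_facts:
  fixes w :: complex
  defines "\<mu> \<equiv> distr real_gaussian borel complex_of_real"
  shows "integrable \<mu> (\<lambda>z. (cmod z)\<^sup>2)" "(CLINT z|\<mu>. z) = 0" "(CLINT z|\<mu>. z * cnj z) = 1"
    "(CLINT z|\<mu>. iexp (Re (w * z))) = of_real (exp (- (LINT z|\<mu>. (Re (w * z))\<^sup>2) / 2))"
proof -
  note G = real_gaussian_facts
  interpret G: prob_space real_gaussian by (rule G)
  have m [measurable]: "complex_of_real \<in> real_gaussian \<rightarrow>\<^sub>M borel"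
    using G(2) by (simp cong: measurable_cong_sets)
  show "integrable \<mu> (\<lambda>z. (cmod z)\<^sup>2)"
    unfolding \<mu>_def using G(4) by (subst integrable_distr_eq) auto
  show "(CLINT z|\<mu>. z) = 0"
    unfolding \<mu>_def using G(5) by (subst integral_distr) auto
  have "(CLINT z|\<mu>. z * cnj z) = (CLINT x|real_gaussian. of_real (x\<^sup>2))"
    unfolding \<mu>_def by (subst integral_distr) (auto simp: power2_eq_square)
  then show "(CLINT z|\<mu>. z * cnj z) = 1" using G(6) by (simp del: of_real_power)
  have 1: "(LINT z|\<mu>. (Re (w * z))\<^sup>2) = (Re w)\<^sup>2"
    unfolding \<mu>_def using G(6) by (subst integral_distr) (auto simp: power_mult_distrib)
  have "(CLINT z|\<mu>. iexp (Re (w * z))) = (CLINT x|real_gaussian. iexp (Re w * x))"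
    unfolding \<mu>_def by (subst integral_distr) auto
  then show "(CLINT z|\<mu>. iexp (Re (w * z))) = of_real (exp (- (LINT z|\<mu>. (Re (w * z))\<^sup>2) / 2))"
    unfolding char_cmult G(7) 1 .
qed

text \<open>Computed from the two independent real coordinates of the product space. The vanishing
  of the mean of \<open>z * z\<close> is what separates odd chains from even ones in the
  covariance.\<close>

lemma complex_gaussian_facts:
  fixes w :: complex
  shows "integrable complex_gaussian (\<lambda>z. (cmod z)\<^sup>2)"
    "(CLINT z|complex_gaussian. z) = 0" "(CLINT z|complex_gaussian. z * cnj z) = 1"
    "(CLINT z|complex_gaussian. z * z) = 0"
    "(CLINT z|complex_gaussian. iexp (Re (w * z)))
      = of_real (exp (- (LINT z|complex_gaussian. (Re (w * z))\<^sup>2) / 2))"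
proof -
  note G = real_gaussian_facts
  interpret G: prob_space real_gaussian by (rule G)
  interpret PP: pair_prob_space real_gaussian real_gaussian ..
  let ?P = "real_gaussian \<Otimes>\<^sub>M real_gaussian"
  let ?Z = "\<lambda>x::real \<times> real. (complex_of_real (fst x) + \<i> * complex_of_real (snd x)) / complex_of_real (sqrt 2)"
  have proj [measurable]: "fst \<in> borel_measurable ?P" "snd \<in> borel_measurable ?P"
    using G(2) by (simp_all cong: measurable_cong_sets)
  have dfst: "distr ?P borel fst = real_gaussian"
    using G.distr_pair_fst[of real_gaussian] G(2) by (metis distr_cong)
  have dsnd: "distr ?P borel snd = real_gaussian"
  proof (rule measure_eqI)
    fix S :: "real set" assume "S \<in> sets (distr ?P borel snd)"
    then have S: "S \<in> sets real_gaussian" using G(2) by simp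
    have "snd -` S \<inter> space ?P = space real_gaussian \<times> S"
      using sets.sets_into_space[OF S] by (auto simp: space_pair_measure)
    then show "emeasure (distr ?P borel snd) S = emeasure real_gaussian S"
      using S G(2) G.emeasure_pair_measure_Times[OF sets.top[of real_gaussian] S]
      by (simp add: emeasure_distr G.emeasure_space_1)
  qed (simp add: G(2))
  have indep: "PP.indep_var borel fst borel snd"
    unfolding PP.indep_var_distribution_eq dfst dsnd
    using G(2) by (auto intro!: distr_id2[symmetric] sets_pair_measure_cong)
  have int: "integrable ?P (\<lambda>x. h (fst x))" "integrable ?P (\<lambda>x. h (snd x))"
    if "integrable real_gaussian h" for h :: "real \<Rightarrow> real"
    using integrable_distr[OF proj(1), unfolded dfst, OF that] integrable_distr[OF proj(2), unfolded dsnd, OF that]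
    by simp_all
  have eq: "(LINT x|?P. h (fst x)) = (LINT x|real_gaussian. h x)" "(LINT x|?P. h (snd x)) = (LINT x|real_gaussian. h x)"
    if "h \<in> borel_measurable borel" for h :: "real \<Rightarrow> real"
    using integral_distr[OF proj(1) that] integral_distr[OF proj(2) that] unfolding dfst dsnd by simp_all
  have lin: "integrable ?P fst" "integrable ?P snd" using int[OF G(3)] by simp_all
  have lin0: "(LINT x|?P. fst x) = 0" "(LINT x|?P. snd x) = 0" using eq[of "\<lambda>x. x"] G(5) by simp_all
  have sq: "integrable ?P (\<lambda>x. (fst x)\<^sup>2)" "integrable ?P (\<lambda>x. (snd x)\<^sup>2)" using int[OF G(4)] by simp_all
  have sq1: "(LINT x|?P. (fst x)\<^sup>2) = 1" "(LINT x|?P. (snd x)\<^sup>2) = 1" using eq[of "\<lambda>x. x\<^sup>2"] G(6) by simp_all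
  have mix: "integrable ?P (\<lambda>x. fst x * snd x)" "(LINT x|?P. fst x * snd x) = 0"
    using PP.indep_var_integrable[OF indep lin] PP.indep_var_lebesgue_integral[OF indep lin] lin0
    by simp_all
  have Z [measurable]: "?Z \<in> borel_measurable ?P" by measurable
  have cg: "complex_gaussian = distr ?P borel ?Z"
    by (simp add: complex_gaussian_def case_prod_unfold)
  have s2: "complex_of_real (sqrt 2) * complex_of_real (sqrt 2) = 2"
    by (simp flip: of_real_mult)
  have n2: "(cmod (?Z x))\<^sup>2 = ((fst x)\<^sup>2 + (snd x)\<^sup>2) / 2" for x
    by (simp add: norm_divide power_divide cmod_power2)
  show "integrable complex_gaussian (\<lambda>z. (cmod z)\<^sup>2)"
    unfolding cg by (subst integrable_distr_eq) (use sq in \<open>simp_all only: n2, auto\<close>)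
  show "(CLINT z|complex_gaussian. z) = 0"
    unfolding cg using lin lin0 by (subst integral_distr) auto
  have "(CLINT z|complex_gaussian. z * cnj z) = (CLINT x|?P. of_real (((fst x)\<^sup>2 + (snd x)\<^sup>2) / 2))"
    unfolding cg by (subst integral_distr, simp, simp, intro Bochner_Integration.integral_cong HOL.refl)
      (simp only: n2[symmetric] complex_norm_square)
  then show "(CLINT z|complex_gaussian. z * cnj z) = 1" using sq sq1 by (simp del: of_real_power of_real_add of_real_divide)
  have "?Z x * ?Z x = of_real (((fst x)\<^sup>2 - (snd x)\<^sup>2) / 2) + \<i> * of_real (fst x * snd x)" for x
    by (simp only: times_divide_times_eq s2) (simp add: power2_eq_square complex_eq_iff)
  then have "(CLINT z|complex_gaussian. z * z)
      = (CLINT x|?P. of_real (((fst x)\<^sup>2 - (snd x)\<^sup>2) / 2) + \<i> * of_real (fst x * snd x))"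
    unfolding cg by (subst integral_distr) simp_all
  also have "\<dots> = of_real (LINT x|?P. ((fst x)\<^sup>2 - (snd x)\<^sup>2) / 2) + \<i> * of_real (LINT x|?P. fst x * snd x)"
    using sq mix(1) by (subst Bochner_Integration.integral_add)
      (auto simp del: of_real_power of_real_mult of_real_divide of_real_diff)
  finally show "(CLINT z|complex_gaussian. z * z) = 0" using sq sq1 mix by simp
  \<comment> \<open>\<open>a\<close> and \<open>b\<close> are the coefficients of the two real
    Gaussians in \<open>Re (w * z)\<close>.\<close>
  define a where "a = Re w / sqrt 2"
  define b where "b = - Im w / sqrt 2"
  have re: "Re (w * ?Z x) = a * fst x + b * snd x" for x
    by (simp add: a_def b_def Re_divide_of_real add_divide_distrib diff_divide_distrib algebra_simps)
  have "(LINT z|complex_gaussian. (Re (w * z))\<^sup>2) = (LINT x|?P. (Re (w * ?Z x))\<^sup>2)"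
    unfolding cg by (subst integral_distr) simp_all
  also have "\<dots> = (LINT x|?P. a\<^sup>2 * (fst x)\<^sup>2 + (2 * a * b * (fst x * snd x) + b\<^sup>2 * (snd x)\<^sup>2))"
    unfolding re by (intro Bochner_Integration.integral_cong HOL.refl) (simp add: power2_eq_square algebra_simps)
  also have "\<dots> = a\<^sup>2 + b\<^sup>2" using sq sq1 mix by simp
  finally have v: "(LINT z|complex_gaussian. (Re (w * z))\<^sup>2) = a\<^sup>2 + b\<^sup>2" .
  have indep': "PP.indep_var borel (\<lambda>x. a * fst x) borel (\<lambda>x. b * snd x)"
    using PP.indep_var_compose[OF indep, of "\<lambda>x. a * x" borel "\<lambda>x. b * x" borel] by (simp add: comp_def)
  have "(CLINT z|complex_gaussian. iexp (Re (w * z))) = (CLINT x|?P. iexp (Re (w * ?Z x)))"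
    unfolding cg by (subst integral_distr) simp_all
  also have "\<dots> = char (distr ?P borel (\<lambda>x. a * fst x + b * snd x)) 1"
    unfolding re char_def by (subst integral_distr) simp_all
  also have "\<dots> = char (distr ?P borel (\<lambda>x. a * fst x)) 1 * char (distr ?P borel (\<lambda>x. b * snd x)) 1"
    by (rule PP.char_distr_add[OF indep'])
  also have "char (distr ?P borel (\<lambda>x. a * fst x)) 1 = (CLINT y|distr ?P borel fst. iexp (a * y))"
    unfolding char_def by (subst (1 2) integral_distr) simp_all
  also have "char (distr ?P borel (\<lambda>x. b * snd x)) 1 = (CLINT y|distr ?P borel snd. iexp (b * y))"
    unfolding char_def by (subst (1 2) integral_distr) simp_all
  also have "(CLINT y|distr ?P borel fst. iexp (a * y)) * (CLINT y|distr ?P borel snd. iexp (b * y))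
      = of_real (exp (- (a\<^sup>2 + b\<^sup>2) / 2))"
    unfolding dfst dsnd char_cmult G(7)
    by (simp only: of_real_mult[symmetric] exp_add[symmetric]) (simp add: add_divide_distrib)
  finally show "(CLINT z|complex_gaussian. iexp (Re (w * z)))
      = of_real (exp (- (LINT z|complex_gaussian. (Re (w * z))\<^sup>2) / 2))" unfolding v .
qed

lemma entry_law_facts:
  shows "integrable (entry_law k f N l j) (\<lambda>z. (cmod z)\<^sup>2)"
    "(CLINT z|entry_law k f N l j. z) = 0" "(CLINT z|entry_law k f N l j. z * cnj z) = 1"
    "(CLINT z|entry_law k f N l j. iexp (Re (w * z)))
      = of_real (exp (- (LINT z|entry_law k f N l j. (Re (w * z))\<^sup>2) / 2))"
proof -
  have "entry_law k f N l j = distr real_gaussian borel complex_of_real \<or> entry_law k f N l j = complex_gaussian"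
    by (simp add: entry_law_def)
  then show "integrable (entry_law k f N l j) (\<lambda>z. (cmod z)\<^sup>2)"
    "(CLINT z|entry_law k f N l j. z) = 0" "(CLINT z|entry_law k f N l j. z * cnj z) = 1"
    "(CLINT z|entry_law k f N l j. iexp (Re (w * z)))
      = of_real (exp (- (LINT z|entry_law k f N l j. (Re (w * z))\<^sup>2) / 2))"
    by (elim disjE; simp only: real_gaussian_of_real_facts complex_gaussian_facts)+
qed

text \<open>Uses \<open>Re x * Re y = (Re (x * cnj y) + Re (x * y)) / 2\<close>. In the second term
  \<open>D q\<close> is replaced by the conjugate of \<open>D (\<tau> q)\<close>, so the covariances
  \<open>C\<close> determine the whole second moment.\<close>

lemma second_moment_Re_sum:
  fixes D :: "'i \<Rightarrow> 'a \<Rightarrow> complex"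
  assumes tr: "\<And>p x. p \<in> I \<Longrightarrow> x \<in> space P \<Longrightarrow> D (\<tau> p) x = cnj (D p x)" "\<And>p. p \<in> I \<Longrightarrow> \<tau> p \<in> I"
    and int: "\<And>p q. p \<in> I \<Longrightarrow> q \<in> I \<Longrightarrow> integrable P (\<lambda>x. D p x * cnj (D q x))"
    and C: "\<And>p q. p \<in> I \<Longrightarrow> q \<in> I \<Longrightarrow> (CLINT x|P. D p x * cnj (D q x)) = C p q"
  shows "(LINT x|P. (\<Sum>p\<in>I. Re (w p * D p x))\<^sup>2)
    = (\<Sum>p\<in>I. \<Sum>q\<in>I. (Re (w p * cnj (w q) * C p q) + Re (w p * w q * C p (\<tau> q))) / 2)"
proof -
  let ?F = "\<lambda>p q x. (Re (w p * cnj (w q) * (D p x * cnj (D q x))) + Re (w p * w q * (D p x * cnj (D (\<tau> q) x)))) / 2"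
  have Re_int: "integrable P (\<lambda>x. Re (c * (D p x * cnj (D r x))))"
    "(LINT x|P. Re (c * (D p x * cnj (D r x)))) = Re (c * C p r)" if "p \<in> I" "r \<in> I" for p r c
  proof -
    have 1: "integrable P (\<lambda>x. c * (D p x * cnj (D r x)))" "(CLINT x|P. c * (D p x * cnj (D r x))) = c * C p r"
      using int[OF that] C[OF that] by simp_all
    show "integrable P (\<lambda>x. Re (c * (D p x * cnj (D r x))))" by (rule integrable_Re[OF 1(1)])
    show "(LINT x|P. Re (c * (D p x * cnj (D r x)))) = Re (c * C p r)"
      unfolding 1(2)[symmetric] by (rule integral_Re[OF 1(1)])
  qed
  have intF: "integrable P (?F p q)" if "p \<in> I" "q \<in> I" for p q
    by (intro integrable_divide_zero Bochner_Integration.integrable_add Re_int that tr(2))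
  have "(LINT x|P. (\<Sum>p\<in>I. Re (w p * D p x))\<^sup>2) = (LINT x|P. (\<Sum>p\<in>I. \<Sum>q\<in>I. ?F p q x))"
  proof (rule Bochner_Integration.integral_cong[OF HOL.refl])
    fix x assume x: "x \<in> space P"
    have "Re (w p * D p x) * Re (w q * D q x) = ?F p q x" if "q \<in> I" for p q
      using tr(1)[OF that x] by (simp add: algebra_simps)
    then show "(\<Sum>p\<in>I. Re (w p * D p x))\<^sup>2 = (\<Sum>p\<in>I. \<Sum>q\<in>I. ?F p q x)"
      unfolding power2_eq_square sum_product by (intro sum.cong HOL.refl) blast
  qed
  also have "\<dots> = (\<Sum>p\<in>I. \<Sum>q\<in>I. (LINT x|P. ?F p q x))"
    by (subst Bochner_Integration.integral_sum, intro Bochner_Integration.integrable_sum intF, assumption+)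
       (intro sum.cong HOL.refl Bochner_Integration.integral_sum intF)
  also have "\<dots> = (\<Sum>p\<in>I. \<Sum>q\<in>I. (Re (w p * cnj (w q) * C p q) + Re (w p * w q * C p (\<tau> q))) / 2)"
  proof (intro sum.cong HOL.refl)
    fix p q assume pq: "p \<in> I" "q \<in> I"
    show "(LINT x|P. ?F p q x) = (Re (w p * cnj (w q) * C p q) + Re (w p * w q * C p (\<tau> q))) / 2"
      by (subst integral_divide_zero, subst Bochner_Integration.integral_add)
         (simp_all only: Re_int[OF pq] Re_int[OF pq(1) tr(2)[OF pq(2)]])
  qed
  finally show ?thesis .
qed

section \<open>Moments and characteristic function of a companion ensemble\<close>

locale companion =
  fixes k n :: nat and f :: "int \<times> int \<Rightarrow> int" and P :: "'a measure" and M :: "'a \<Rightarrow> complex mat"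
  assumes ens: "complex_companion_ensemble k f n P M"
begin

abbreviation "grid \<equiv> {0..<n} \<times> {0..<n}"

lemmas ens_conjuncts = ens[unfolded complex_companion_ensemble_def]

sublocale prob_space P
  using ens_conjuncts by (elim conjE)

lemma carrier: "\<omega> \<in> space P \<Longrightarrow> M \<omega> \<in> carrier_mat n n"
  using ens_conjuncts by (elim conjE) (rule bspec)

lemma entry_law:
  assumes "p \<in> grid"
  shows "(\<lambda>\<omega>. M \<omega> $$ p) \<in> borel_measurable P \<and>
    distr P borel (\<lambda>\<omega>. M \<omega> $$ p) = entry_law k f n (fst p) (snd p)"
proof -
  have *: "\<forall>l<n. \<forall>j<n. (\<lambda>\<omega>. M \<omega> $$ (l, j)) \<in> borel_measurable P \<and>
      distr P borel (\<lambda>\<omega>. M \<omega> $$ (l, j)) = entry_law k f n l j"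
    using ens_conjuncts by (elim conjE)
  obtain l j where "p = (l, j)" by (cases p)
  then show ?thesis using *[THEN spec, of l, THEN mp, THEN spec, of j] assms by simp
qed

lemmas entry_measurable [measurable] = entry_law[THEN conjunct1]
  and distr_entry = entry_law[THEN conjunct2]

lemma cnj_entry:
  assumes "\<omega> \<in> space P" "(l, j) \<in> grid"
  shows "cnj (M \<omega> $$ (l, j)) = M \<omega> $$ (j, l)"
proof -
  have *: "\<forall>l<n. \<forall>j<n. M \<omega> $$ (l, j) = cnj (M \<omega> $$ (j, l))" using ens_conjuncts assms(1) by blast
  have "M \<omega> $$ (j, l) = cnj (M \<omega> $$ (l, j))" by (rule *[rule_format]) (use assms in auto)
  then show ?thesis ..
qed

lemma same_entryD:
  assumes "\<omega> \<in> space P" "p \<in> grid" "q \<in> grid" "same_entry k f n p q"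
  shows "M \<omega> $$ p = M \<omega> $$ q"
proof -
  have *: "\<forall>l<n. \<forall>j<n. \<forall>m<n. \<forall>i<n. same_entry k f n (l, j) (m, i) \<longrightarrow> M \<omega> $$ (l, j) = M \<omega> $$ (m, i)"
    using ens_conjuncts assms(1) by blast
  obtain l j m i where "p = (l, j)" "q = (m, i)" by (cases p; cases q)
  then show ?thesis using *[rule_format, of l j m i] assms(2-4) by simp
qed

lemma indep_unlinked:
  "R \<subseteq> grid \<Longrightarrow> pairwise (\<lambda>p q. \<not> linked k f n p q) R \<Longrightarrow> indep_vars (\<lambda>_. borel) (\<lambda>p \<omega>. M \<omega> $$ p) R"
  using ens_conjuncts by blast

lemma parity_linked_entry:
  assumes "parity_linked k f n b p q" "\<omega> \<in> space P"
  shows "M \<omega> $$ q = (if b then M \<omega> $$ p else cnj (M \<omega> $$ p))"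
  using assms(1)
proof induction
  case (start p)
  show ?case by simp
next
  case (transpose b p l j)
  have "M \<omega> $$ (j, l) = cnj (M \<omega> $$ (l, j))"
    using parity_linked_grid[OF transpose.hyps] cnj_entry[OF assms(2)] by auto
  then show ?case using transpose.IH by auto
next
  case (step b p q r)
  then show ?case using same_entryD[OF assms(2), of q r] parity_linked_grid[OF step.hyps(1)] by simp
qed

lemma integrable_norm_sq:
  assumes p: "p \<in> grid"
  shows "integrable P (\<lambda>\<omega>. (cmod (M \<omega> $$ p))\<^sup>2)"
  using integrable_distr[OF entry_measurable[OF p], unfolded distr_entry[OF p], OF entry_law_facts(1)] .

lemma integral_entry:
  fixes h :: "complex \<Rightarrow> 'b :: {banach, second_countable_topology}"
  assumes p: "p \<in> grid" and [measurable]: "h \<in> borel_measurable borel"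
  shows "(LINT \<omega>|P. h (M \<omega> $$ p)) = (LINT z|entry_law k f n (fst p) (snd p). h z)"
  using integral_distr[OF entry_measurable[OF p] assms(2)] unfolding distr_entry[OF p] ..

lemma integrable_prod:
  assumes p: "p \<in> grid" and q: "q \<in> grid"
  shows "integrable P (\<lambda>\<omega>. M \<omega> $$ p * cnj (M \<omega> $$ q))"
proof (rule Bochner_Integration.integrable_bound)
  show "integrable P (\<lambda>\<omega>. (cmod (M \<omega> $$ p))\<^sup>2 + (cmod (M \<omega> $$ q))\<^sup>2)"
    by (intro Bochner_Integration.integrable_add integrable_norm_sq p q)
  have "x * y \<le> x\<^sup>2 + y\<^sup>2" if "x \<ge> 0" "y \<ge> 0" for x y :: real
    using sum_squares_bound[of x y] that mult_nonneg_nonneg[OF that] by linarith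
  then show "AE \<omega> in P. norm (M \<omega> $$ p * cnj (M \<omega> $$ q)) \<le> norm ((cmod (M \<omega> $$ p))\<^sup>2 + (cmod (M \<omega> $$ q))\<^sup>2)"
    by (auto simp: norm_mult)
qed (use p q in measurable)

lemma integrable_entry:
  assumes p: "p \<in> grid"
  shows "integrable P (\<lambda>\<omega>. M \<omega> $$ p)"
proof (rule Bochner_Integration.integrable_bound)
  show "integrable P (\<lambda>\<omega>. 1 + (cmod (M \<omega> $$ p))\<^sup>2)"
    by (intro Bochner_Integration.integrable_add integrable_norm_sq p) simp
  have "x \<le> 1 + x\<^sup>2" for x :: real
  proof -
    have "2 * x \<le> x\<^sup>2 + 1" using sum_squares_bound[of x 1] by simp
    then show ?thesis using zero_le_power2[of x] by linarith
  qed
  then show "AE \<omega> in P. norm (M \<omega> $$ p) \<le> norm (1 + (cmod (M \<omega> $$ p))\<^sup>2)"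
    by auto
qed (use p in measurable)

lemma expectation_entry: "p \<in> grid \<Longrightarrow> (CLINT \<omega>|P. M \<omega> $$ p) = 0"
  using integral_entry[of p "\<lambda>z. z"] entry_law_facts(2) by simp

lemma indep_pair_integral:
  fixes g h :: "complex \<Rightarrow> 'b :: {real_normed_field, banach, second_countable_topology}"
  assumes p: "p \<in> grid" and q: "q \<in> grid" and unlinked: "\<not> linked k f n p q"
    and [measurable]: "g \<in> borel_measurable borel" "h \<in> borel_measurable borel"
    and int: "integrable P (\<lambda>\<omega>. g (M \<omega> $$ p))" "integrable P (\<lambda>\<omega>. h (M \<omega> $$ q))"
  shows "(LINT \<omega>|P. g (M \<omega> $$ p) * h (M \<omega> $$ q)) = (LINT \<omega>|P. g (M \<omega> $$ p)) * (LINT \<omega>|P. h (M \<omega> $$ q))"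
proof -
  have ne: "p \<noteq> q" using unlinked linked.refl[OF p] by blast
  have "\<not> linked k f n q p" using unlinked parity_linked_sym unfolding linked_iff_parity_linked by blast
  then have "indep_vars (\<lambda>_. borel) (\<lambda>p \<omega>. M \<omega> $$ p) {p, q}"
    using p q unlinked by (intro indep_unlinked) (auto simp: pairwise_def)
  then have "indep_vars (\<lambda>_. borel) (\<lambda>i \<omega>. (if i = p then g else h) (M \<omega> $$ i)) {p, q}"
    by (rule indep_vars_compose2) auto
  moreover have "integrable P (\<lambda>\<omega>. (if i = p then g else h) (M \<omega> $$ i))" if "i \<in> {p, q}" for i
    using that int by auto
  ultimately show ?thesis
    using indep_vars_lebesgue_integral[of "{p, q}" "\<lambda>i \<omega>. (if i = p then g else h) (M \<omega> $$ i)"] ne by simp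
qed

text \<open>For an even chain the entries are equal and the variance is 1. If only odd chains exist,
  the second entry is the conjugate of the first and the expectation is that of
  \<open>z * z\<close>. Unlinked entries are independent and centred.\<close>

lemma covariance:
  assumes p: "p \<in> grid" and q: "q \<in> grid"
  shows "(CLINT \<omega>|P. M \<omega> $$ p * cnj (M \<omega> $$ q)) = of_bool (parity_linked k f n True p q)"
proof -
  consider "parity_linked k f n True p q" | "\<not> parity_linked k f n True p q" "parity_linked k f n False p q"
    | "\<not> linked k f n p q"
    unfolding linked_iff_parity_linked by (metis (full_types))
  then show ?thesis
  proof cases
    case 1
    have "(CLINT \<omega>|P. M \<omega> $$ p * cnj (M \<omega> $$ q)) = (CLINT \<omega>|P. M \<omega> $$ p * cnj (M \<omega> $$ p))"
      by (rule Bochner_Integration.integral_cong) (simp_all add: parity_linked_entry[OF 1])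
    then show ?thesis using 1 integral_entry[OF p, of "\<lambda>z. z * cnj z"] entry_law_facts(3) by simp
  next
    case 2
    obtain l j where lj: "p = (l, j)" by (cases p)
    \<comment> \<open>If the real law were prescribed at \<open>p\<close>, the transposed position
      would carry the same entry, giving an odd chain from \<open>p\<close> to itself. Prefixing it
      would turn the odd chain to \<open>q\<close> into an even one.\<close>
    have not_real: "\<not> ([2 * (int j - int l) = 0] (mod int n) \<and> link_at k f j l = link_at k f l j)"
    proof
      assume *: "[2 * (int j - int l) = 0] (mod int n) \<and> link_at k f j l = link_at k f l j"
      have "[int j - int l = int l - int j] (mod int n)"
        using * by (simp add: cong_iff_dvd_diff algebra_simps)
      then have "same_entry k f n (j, l) (l, j)" using * by (simp add: same_entry_def)
      moreover have "parity_linked k f n (\<not> True) p (j, l)"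
        using p unfolding lj by (intro parity_linked.transpose parity_linked.start)
      ultimately have "parity_linked k f n False p p"
        using p lj by (auto intro: parity_linked.step)
      from parity_linked_trans[OF this 2(2)] 2(1) show False by simp
    qed
    have law: "entry_law k f n (fst p) (snd p) = complex_gaussian"
      by (simp only: entry_law_def lj fst_conv snd_conv if_not_P[OF not_real])
    have "(CLINT \<omega>|P. M \<omega> $$ p * cnj (M \<omega> $$ q)) = (CLINT \<omega>|P. M \<omega> $$ p * M \<omega> $$ p)"
      by (rule Bochner_Integration.integral_cong) (simp_all add: parity_linked_entry[OF 2(2)])
    then show ?thesis
      using 2 integral_entry[OF p, of "\<lambda>z. z * z"] complex_gaussian_facts(4) law by simp
  next
    case 3
    then have "(CLINT \<omega>|P. M \<omega> $$ p * cnj (M \<omega> $$ q)) = (CLINT \<omega>|P. M \<omega> $$ p) * (CLINT \<omega>|P. cnj (M \<omega> $$ q))"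
      by (intro indep_pair_integral[OF p q, where g="\<lambda>z. z" and h=cnj]) (auto intro!: integrable_entry p q)
    moreover have "\<not> parity_linked k f n True p q" using 3 by (auto simp: linked_iff_parity_linked)
    ultimately show ?thesis using expectation_entry[OF p] by simp
  qed
qed

lemma char_Re_entry:
  assumes p: "p \<in> grid"
  shows "(CLINT \<omega>|P. iexp (Re (w * M \<omega> $$ p))) = of_real (exp (- (LINT \<omega>|P. (Re (w * M \<omega> $$ p))\<^sup>2) / 2))"
proof -
  have "(CLINT \<omega>|P. iexp (Re (w * M \<omega> $$ p))) = (CLINT z|entry_law k f n (fst p) (snd p). iexp (Re (w * z)))"
    by (rule integral_entry[OF p, where h="\<lambda>z. iexp (Re (w * z))"]) measurable
  moreover have "(LINT \<omega>|P. (Re (w * M \<omega> $$ p))\<^sup>2) = (LINT z|entry_law k f n (fst p) (snd p). (Re (w * z))\<^sup>2)"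
    by (rule integral_entry[OF p, where h="\<lambda>z. (Re (w * z))\<^sup>2"]) measurable
  ultimately show ?thesis by (simp only: entry_law_facts(4))
qed

end

lemma linked_equiv:
  shows linked_sym: "linked k f N p q \<Longrightarrow> linked k f N q p"
    and linked_trans: "linked k f N p q \<Longrightarrow> linked k f N q r \<Longrightarrow> linked k f N p r"
  unfolding linked_iff_parity_linked using parity_linked_sym parity_linked_trans by blast+

context companion
begin

text \<open>Linked entries agree up to conjugation, so the functional collapses to one term per
  class. The class terms are independent, each has the Gaussian characteristic function, and their
  second moments add since the cross terms vanish.\<close>

lemma char_linear:
  fixes w :: "nat \<times> nat \<Rightarrow> complex"
  shows "(CLINT \<omega>|P. iexp (\<Sum>p\<in>grid. Re (w p * M \<omega> $$ p)))
    = of_real (exp (- (LINT \<omega>|P. (\<Sum>p\<in>grid. Re (w p * M \<omega> $$ p))\<^sup>2) / 2))"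
proof -
  \<comment> \<open>The choice depends only on the predicate \<open>linked k f n p\<close>, so
    linked positions receive the same representative.\<close>
  define \<rho> where "\<rho> p = (SOME q. linked k f n p q)" for p
  define R where "R = \<rho> ` grid"
  have \<rho>: "linked k f n p (\<rho> p)" if "p \<in> grid" for p
    unfolding \<rho>_def by (rule someI) (rule linked.refl[OF that])
  have \<rho>_eq: "\<rho> p = \<rho> q" if "linked k f n p q" for p q
  proof -
    have "linked k f n p = linked k f n q"
      using linked_sym linked_trans that by (intro ext iffI) blast+
    then show ?thesis by (simp add: \<rho>_def)
  qed
  have "\<rho> p \<in> grid" if "p \<in> grid" for p
    using \<rho>[OF that] parity_linked_grid[of k f n _ p "\<rho> p"] unfolding linked_iff_parity_linked by blast
  then have R: "finite R" "R \<subseteq> grid" unfolding R_def by blast+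
  have unlinked: "\<not> linked k f n r s" if prems: "r \<in> R" "s \<in> R" "r \<noteq> s" for r s
  proof
    assume rs: "linked k f n r s"
    obtain p q where pq: "p \<in> grid" "r = \<rho> p" "q \<in> grid" "s = \<rho> q" using prems unfolding R_def by blast
    have "linked k f n p s" using linked_trans[OF \<rho>[OF pq(1)]] rs pq(2) by simp
    then have "linked k f n p q" using linked_trans linked_sym[OF \<rho>[OF pq(3)]] pq(4) by blast
    then have "\<rho> p = \<rho> q" by (rule \<rho>_eq)
    then show False using prems pq by simp
  qed
  define par where "par p = (SOME b. parity_linked k f n b (\<rho> p) p)" for p
  have par: "parity_linked k f n (par p) (\<rho> p) p" if "p \<in> grid" for p
    unfolding par_def using linked_sym[OF \<rho>[OF that]] unfolding linked_iff_parity_linked by (rule someI_ex)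
  \<comment> \<open>Since \<open>Re (w * cnj z) = Re (cnj w * z)\<close>, the conjugation caused by
    an odd chain is moved from the entry to its coefficient.\<close>
  define v where "v p = (if par p then w p else cnj (w p))" for p
  define W where "W r = (\<Sum>p\<in>{p \<in> grid. \<rho> p = r}. v p)" for r
  define X where "X r \<omega> = Re (W r * M \<omega> $$ r)" for r \<omega>
  have sum_eq: "(\<Sum>p\<in>grid. Re (w p * M \<omega> $$ p)) = (\<Sum>r\<in>R. X r \<omega>)" if \<omega>: "\<omega> \<in> space P" for \<omega>
  proof -
    have "Re (w p * M \<omega> $$ p) = Re (v p * M \<omega> $$ (\<rho> p))" if "p \<in> grid" for p
      using parity_linked_entry[OF par[OF that] \<omega>] by (simp add: v_def)
    then have "(\<Sum>p\<in>grid. Re (w p * M \<omega> $$ p)) = (\<Sum>p\<in>grid. Re (v p * M \<omega> $$ (\<rho> p)))"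
      by (rule sum.cong[OF HOL.refl])
    also have "\<dots> = (\<Sum>r\<in>R. \<Sum>p\<in>{p \<in> grid. \<rho> p = r}. Re (v p * M \<omega> $$ (\<rho> p)))"
      unfolding R_def by (rule sum.image_gen) simp
    also have "\<dots> = (\<Sum>r\<in>R. X r \<omega>)"
    proof (rule sum.cong[OF HOL.refl])
      fix r
      have "(\<Sum>p\<in>{p \<in> grid. \<rho> p = r}. Re (v p * M \<omega> $$ (\<rho> p))) = (\<Sum>p\<in>{p \<in> grid. \<rho> p = r}. Re (v p * M \<omega> $$ r))"
        by (rule sum.cong) auto
      also have "\<dots> = X r \<omega>" unfolding X_def W_def sum_distrib_right Re_sum ..
      finally show "(\<Sum>p\<in>{p \<in> grid. \<rho> p = r}. Re (v p * M \<omega> $$ (\<rho> p))) = X r \<omega>" .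
    qed
    finally show ?thesis .
  qed
  have [measurable]: "X r \<in> borel_measurable P" if "r \<in> R" for r
  proof -
    have "r \<in> grid" using that R by blast
    then show ?thesis unfolding X_def[abs_def] by measurable
  qed
  have indep: "indep_vars (\<lambda>_. borel) X R"
    unfolding X_def[abs_def]
    by (rule indep_vars_compose2[where X="\<lambda>p \<omega>. M \<omega> $$ p" and M'="\<lambda>_. borel"],
        rule indep_unlinked) (use R unlinked in \<open>auto simp: pairwise_def\<close>)
  have X_sq: "integrable P (\<lambda>\<omega>. (X r \<omega>)\<^sup>2)" if r: "r \<in> R" for r
  proof (rule Bochner_Integration.integrable_bound)
    show "integrable P (\<lambda>\<omega>. (cmod (W r))\<^sup>2 * (cmod (M \<omega> $$ r))\<^sup>2)"
      by (intro integrable_mult_right integrable_norm_sq) (use R r in auto)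
    have "\<bar>X r \<omega>\<bar> \<le> cmod (W r) * cmod (M \<omega> $$ r)" for \<omega>
      unfolding X_def norm_mult[symmetric] by (rule abs_Re_le_cmod)
    then have "\<bar>X r \<omega>\<bar>\<^sup>2 \<le> (cmod (W r) * cmod (M \<omega> $$ r))\<^sup>2" for \<omega>
      by (intro power_mono) auto
    then show "AE \<omega> in P. norm ((X r \<omega>)\<^sup>2) \<le> norm ((cmod (W r))\<^sup>2 * (cmod (M \<omega> $$ r))\<^sup>2)"
      by (simp add: power_mult_distrib)
  qed (use r in measurable)
  have X_int: "integrable P (X r)" "expectation (X r) = 0" if r: "r \<in> R" for r
  proof -
    have g: "r \<in> grid" using r R by auto
    have *: "integrable P (\<lambda>\<omega>. W r * M \<omega> $$ r)" using integrable_entry[OF g] by simp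
    show "integrable P (X r)" unfolding X_def[abs_def] by (rule integrable_Re[OF *])
    show "expectation (X r) = 0"
      unfolding X_def[abs_def] integral_Re[OF *] using integrable_entry[OF g] expectation_entry[OF g] by simp
  qed
  have X_cov: "integrable P (\<lambda>\<omega>. X r \<omega> * X s \<omega>) \<and>
      expectation (\<lambda>\<omega>. X r \<omega> * X s \<omega>) = (if r = s then expectation (\<lambda>\<omega>. (X r \<omega>)\<^sup>2) else 0)"
    if rs: "r \<in> R" "s \<in> R" for r s
  proof (cases "r = s")
    case True
    then show ?thesis using X_sq[OF rs(1)] by (simp add: power2_eq_square)
  next
    case False
    have i: "indep_vars (\<lambda>_. borel) X {r, s}" by (rule indep_vars_subset[OF indep]) (use rs in auto)
    have "\<And>i. i \<in> {r, s} \<Longrightarrow> integrable P (X i)" using X_int rs by auto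
    note indep_vars_integrable[OF _ i this] indep_vars_lebesgue_integral[OF _ i this]
    then show ?thesis using False X_int(2)[OF rs(1)] by simp
  qed
  have "expectation (\<lambda>\<omega>. (\<Sum>p\<in>grid. Re (w p * M \<omega> $$ p))\<^sup>2) = expectation (\<lambda>\<omega>. \<Sum>r\<in>R. \<Sum>s\<in>R. X r \<omega> * X s \<omega>)"
    by (rule Bochner_Integration.integral_cong[OF HOL.refl]) (simp only: sum_eq power2_eq_square sum_product)
  also have "\<dots> = (\<Sum>r\<in>R. expectation (\<lambda>\<omega>. \<Sum>s\<in>R. X r \<omega> * X s \<omega>))"
    by (rule Bochner_Integration.integral_sum) (intro Bochner_Integration.integrable_sum X_cov[THEN conjunct1])
  also have "\<dots> = (\<Sum>r\<in>R. \<Sum>s\<in>R. expectation (\<lambda>\<omega>. X r \<omega> * X s \<omega>))"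
    by (intro sum.cong HOL.refl Bochner_Integration.integral_sum X_cov[THEN conjunct1])
  also have "\<dots> = (\<Sum>r\<in>R. \<Sum>s\<in>R. if r = s then expectation (\<lambda>\<omega>. (X r \<omega>)\<^sup>2) else 0)"
    by (intro sum.cong HOL.refl X_cov[THEN conjunct2])
  also have "\<dots> = (\<Sum>r\<in>R. expectation (\<lambda>\<omega>. (X r \<omega>)\<^sup>2))" using R(1) by simp
  finally have var: "expectation (\<lambda>\<omega>. (\<Sum>p\<in>grid. Re (w p * M \<omega> $$ p))\<^sup>2) = (\<Sum>r\<in>R. expectation (\<lambda>\<omega>. (X r \<omega>)\<^sup>2))" .
  have "(CLINT \<omega>|P. iexp (\<Sum>p\<in>grid. Re (w p * M \<omega> $$ p))) = (CLINT \<omega>|P. iexp (\<Sum>r\<in>R. X r \<omega>))"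
    by (rule Bochner_Integration.integral_cong[OF HOL.refl]) (simp only: sum_eq)
  also have "\<dots> = char (distr P borel (\<lambda>\<omega>. \<Sum>r\<in>R. X r \<omega>)) 1"
    unfolding char_def by (subst integral_distr) auto
  also have "\<dots> = (\<Prod>r\<in>R. char (distr P borel (X r)) 1)" by (rule char_distr_sum[OF indep])
  also have "\<dots> = (\<Prod>r\<in>R. of_real (exp (- expectation (\<lambda>\<omega>. (X r \<omega>)\<^sup>2) / 2)))"
  proof (rule prod.cong[OF HOL.refl])
    fix r assume r: "r \<in> R"
    have "char (distr P borel (X r)) 1 = (CLINT \<omega>|P. iexp (X r \<omega>))"
      unfolding char_def using r by (subst integral_distr) auto
    then show "char (distr P borel (X r)) 1 = of_real (exp (- expectation (\<lambda>\<omega>. (X r \<omega>)\<^sup>2) / 2))"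
      unfolding X_def using char_Re_entry[of r "W r"] r R by auto
  qed
  also have "\<dots> = of_real (exp (- (\<Sum>r\<in>R. expectation (\<lambda>\<omega>. (X r \<omega>)\<^sup>2)) / 2))"
    unfolding of_real_prod[symmetric] exp_sum[OF R(1), symmetric] by (simp add: sum_negf sum_divide_distrib)
  finally show ?thesis unfolding var .
qed

end

section \<open>Block circulant matrices\<close>

definition fiber :: "nat \<Rightarrow> nat \<Rightarrow> nat \<Rightarrow> nat set" where
  "fiber k N j = {u \<in> {..<N}. u mod k = j}"

text \<open>An additive character of the integers modulo \<open>N\<close>; the argument is an
  integer because index differences of either sign occur.\<close>

definition phase :: "nat \<Rightarrow> nat \<Rightarrow> int \<Rightarrow> complex" where
  "phase N s x = cis (2 * pi * real s * of_int x / real N)"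

lemma phase_0 [simp]: "phase N s 0 = 1"
  by (simp add: phase_def)

lemma phase_add: "phase N s (x + y) = phase N s x * phase N s y"
  by (simp add: phase_def cis_mult add_divide_distrib distrib_left)

lemma cnj_phase: "cnj (phase N s x) = phase N s (- x)"
  by (simp add: phase_def cis_cnj)

lemma phase_mult_cnj [simp]: "phase N s x * cnj (phase N s x) = 1"
  by (simp add: cnj_phase flip: phase_add)

lemma phase_cong:
  assumes "N > 0" "[x = y] (mod int N)"
  shows "phase N s x = phase N s y"
proof -
  obtain t where t: "x = y + int N * t" using cong_sym[OF assms(2)] unfolding cong_iff_lin by blast
  have "2 * pi * real s * of_int (int N * t) / real N = 2 * pi * of_int (int s * t)"
    using assms(1) by simp
  then have "phase N s (int N * t) = cis (2 * pi * of_int (int s * t))"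
    by (simp only: phase_def)
  also have "\<dots> = 1" by (rule cis_multiple_2pi) simp
  finally show ?thesis unfolding t by (simp add: phase_add)
qed

section \<open>Translations modulo \<open>N\<close> and residue classes modulo
  \<open>k\<close>\<close>

definition cyclic_shift :: "nat \<Rightarrow> int \<Rightarrow> nat \<Rightarrow> nat" where
  "cyclic_shift N c u = nat ((int u + c) mod int N)"

lemma int_cyclic_shift: "N > 0 \<Longrightarrow> int (cyclic_shift N c u) = (int u + c) mod int N"
  by (simp add: cyclic_shift_def)

lemma cyclic_shift_less: "N > 0 \<Longrightarrow> cyclic_shift N c u < N"
  by (simp add: cyclic_shift_def nat_less_iff)

lemma cyclic_shift_cong: "N > 0 \<Longrightarrow> [int (cyclic_shift N c u) = int u + c] (mod int N)"
  by (simp add: int_cyclic_shift cong_def)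

lemma cyclic_shift_inverse:
  assumes "u < N"
  shows "cyclic_shift N (- c) (cyclic_shift N c u) = u"
proof -
  have "int (cyclic_shift N (- c) (cyclic_shift N c u)) = int u"
    using assms by (simp add: int_cyclic_shift mod_diff_left_eq)
  then show ?thesis by simp
qed

lemma cyclic_shift_mod:
  assumes "N > 0" "k dvd N" "int k dvd c"
  shows "cyclic_shift N c u mod k = u mod k"
proof -
  have "int (cyclic_shift N c u mod k) = (int u + c) mod int k"
    using assms by (simp add: zmod_int int_cyclic_shift mod_mod_cancel)
  also have "\<dots> = int (u mod k)" using assms(3) by (auto simp: zmod_int elim!: dvdE)
  finally show ?thesis by simp
qed

lemma bij_betw_cyclic_shift:
  assumes "N > 0"
  shows "bij_betw (cyclic_shift N c) {..<N} {..<N}"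
  by (rule bij_betw_byWitness[where f'="cyclic_shift N (- c)"])
     (use assms cyclic_shift_inverse[of _ N c] cyclic_shift_inverse[of _ N "- c"] in \<open>auto simp: cyclic_shift_less\<close>)

lemma bij_betw_cyclic_shift_fiber:
  assumes "N > 0" "k dvd N" "int k dvd c"
  shows "bij_betw (cyclic_shift N c) (fiber k N j) (fiber k N j)"
  by (rule bij_betw_byWitness[where f'="cyclic_shift N (- c)"])
     (use assms cyclic_shift_inverse[of _ N c] cyclic_shift_inverse[of _ N "- c"] in \<open>auto simp: cyclic_shift_less cyclic_shift_mod fiber_def\<close>)

lemma sum_fibers:
  assumes "k > 0"
  shows "(\<Sum>j<k. \<Sum>u\<in>fiber k N j. h u) = (\<Sum>u<N. h u)"
  unfolding fiber_def by (rule sum.group) (use assms in auto)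

lemma fiber_mult:
  assumes "k > 0" "j < k"
  shows "fiber k (k * m) j = (\<lambda>t. j + k * t) ` {..<m}"
proof (intro equalityI subsetI)
  fix u assume u: "u \<in> fiber k (k * m) j"
  then have "u = j + k * (u div k)" by (auto simp: fiber_def)
  moreover have "u div k < m" using u assms by (auto simp: fiber_def div_less_iff_less_mult mult.commute)
  ultimately show "u \<in> (\<lambda>t. j + k * t) ` {..<m}" by blast
next
  fix u assume "u \<in> (\<lambda>t. j + k * t) ` {..<m}"
  then obtain t where t: "u = j + k * t" "t < m" by auto
  have "j + k * t < k * Suc t" using assms by simp
  also have "\<dots> \<le> k * m" using t by (intro mult_le_mono2) simp
  finally show "u \<in> fiber k (k * m) j" using t assms by (simp add: fiber_def)
qed

lemma card_fiber:
  assumes "k > 0" "j < k"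
  shows "card (fiber k (k * m) j) = m"
  unfolding fiber_mult[OF assms] using assms by (subst card_image) (auto simp: inj_on_def)

text \<open>For \<open>k dvd N\<close> this says that translating both indices modulo
  \<open>N\<close> by the same multiple of \<open>k\<close> keeps the entry. The congruence form is
  the one that \<open>same_entry\<close> supplies.\<close>

definition block_circulant :: "nat \<Rightarrow> nat \<Rightarrow> complex mat \<Rightarrow> bool" where
  "block_circulant k N X \<longleftrightarrow> X \<in> carrier_mat N N \<and>
     (\<forall>i<N. \<forall>j<N. \<forall>i'<N. \<forall>j'<N. i mod k = i' mod k \<longrightarrow> j mod k = j' mod k \<longrightarrow>
        [int i - int j = int i' - int j'] (mod int N) \<longrightarrow> X $$ (i, j) = X $$ (i', j'))"

lemma block_circulantD:
  assumes "block_circulant k N X" "i < N" "j < N" "i' < N" "j' < N" "i mod k = i' mod k" "j mod k = j' mod k"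
    "[int i - int j = int i' - int j'] (mod int N)"
  shows "X $$ (i, j) = X $$ (i', j')"
  using assms unfolding block_circulant_def by blast

lemma block_circulant_carrier: "block_circulant k N X \<Longrightarrow> X \<in> carrier_mat N N"
  by (simp add: block_circulant_def)

lemma mat_mult_entry:
  assumes "X \<in> carrier_mat n n" "Y \<in> carrier_mat n n" "i < n" "j < n"
  shows "(X * Y) $$ (i, j) = (\<Sum>v<n. X $$ (i, v) * Y $$ (v, j))"
  using assms by (auto simp: scalar_prod_def lessThan_atLeast0)

lemma dvd_diff_of_mod_eq: "i mod k = i' mod k \<Longrightarrow> int k dvd int i' - int i"
  by (metis mod_eq_dvd_iff of_nat_mod)

lemma block_circulant_mult:
  assumes X: "block_circulant k N X" and Y: "block_circulant k N Y" and kN: "k dvd N" "N > 0"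
  shows "block_circulant k N (X * Y)"
proof -
  note c = block_circulant_carrier[OF X] block_circulant_carrier[OF Y]
  have *: "(X * Y) $$ (i, j) = (X * Y) $$ (i', j')"
    if b: "i < N" "j < N" "i' < N" "j' < N" and m: "i mod k = i' mod k" "j mod k = j' mod k"
      and d: "[int i - int j = int i' - int j'] (mod int N)" for i j i' j'
  proof -
    \<comment> \<open>Translating the summation index by \<open>e\<close>, a multiple of
      \<open>k\<close>, matches the two products factor by factor.\<close>
    define e where "e = int i' - int i"
    have e: "int k dvd e" unfolding e_def by (rule dvd_diff_of_mod_eq[OF m(1)])
    have "(\<Sum>v<N. X $$ (i', v) * Y $$ (v, j')) = (\<Sum>v<N. X $$ (i', cyclic_shift N e v) * Y $$ (cyclic_shift N e v, j'))"
      by (rule sum.reindex_bij_betw[symmetric, OF bij_betw_cyclic_shift[OF kN(2)]])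
    also have "\<dots> = (\<Sum>v<N. X $$ (i, v) * Y $$ (v, j))"
    proof (rule sum.cong[OF HOL.refl])
      fix v assume "v \<in> {..<N}"
      then have v: "v < N" by simp
      have sv: "[int (cyclic_shift N e v) = int v + (int i' - int i)] (mod int N)"
        using cyclic_shift_cong[OF kN(2), of e v] by (simp add: e_def)
      have "[int i' - int (cyclic_shift N e v) = int i' - (int v + (int i' - int i))] (mod int N)"
        by (rule cong_diff[OF cong_refl sv])
      then have 1: "[int i' - int (cyclic_shift N e v) = int i - int v] (mod int N)" by simp
      have "[int (cyclic_shift N e v) - int j' = int v + (int i' - int i) - int j'] (mod int N)"
        by (rule cong_diff[OF sv cong_refl])
      moreover have "[int v - int i + (int i - int j) = int v - int i + (int i' - int j')] (mod int N)"
        by (rule cong_add[OF cong_refl d])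
      ultimately have 2: "[int (cyclic_shift N e v) - int j' = int v - int j] (mod int N)"
        by (simp add: algebra_simps) (meson cong_trans cong_sym)
      show "X $$ (i', cyclic_shift N e v) * Y $$ (cyclic_shift N e v, j') = X $$ (i, v) * Y $$ (v, j)"
        using block_circulantD[OF X b(3) cyclic_shift_less[OF kN(2)] b(1) v m(1)[symmetric] cyclic_shift_mod[OF kN(2,1) e] 1]
          block_circulantD[OF Y cyclic_shift_less[OF kN(2)] b(4) v b(2) cyclic_shift_mod[OF kN(2,1) e] m(2)[symmetric] 2]
        by simp
    qed
    finally show ?thesis using b c by (simp only: mat_mult_entry[OF c])
  qed
  show ?thesis
    unfolding block_circulant_def by (intro conjI allI impI mult_carrier_mat[OF c]) (rule *)
qed

lemma block_circulant_one:
  assumes "N > 0"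
  shows "block_circulant k N (1\<^sub>m N)"
proof -
  have iff: "i = j \<longleftrightarrow> i' = j'" if "i < N" "j < N" "i' < N" "j' < N"
    "[int i - int j = int i' - int j'] (mod int N)" for i j i' j'
  proof -
    have *: "a = b \<longleftrightarrow> [int a - int b = 0] (mod int N)" if "a < N" "b < N" for a b
      using that by (auto simp: cong_diff_iff_cong_0 cong_int_iff cong_less_modulus_unique_nat)
    show ?thesis unfolding *[OF that(1,2)] *[OF that(3,4)] using that(5) by (meson cong_trans cong_sym)
  qed
  show ?thesis
    unfolding block_circulant_def
  proof (intro conjI allI impI one_carrier_mat)
    fix i j i' j' assume b: "i < N" "j < N" "i' < N" "j' < N" and d: "[int i - int j = int i' - int j'] (mod int N)"
    show "1\<^sub>m N $$ (i, j) = (1\<^sub>m N :: complex mat) $$ (i', j')"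
      using iff[OF b d] b by simp
  qed
qed

text \<open>For a block circulant \<open>X\<close>, the vectors
  \<open>u -> phase N s u * y (u mod k)\<close> form an invariant subspace, and this is the matrix
  of \<open>X\<close> on it in the coordinates \<open>y\<close>. With \<open>N = k * m\<close>, the
  frequencies \<open>s\<close> and \<open>s + m\<close> give the same subspace, so only
  \<open>s < m\<close> is summed over later.\<close>

definition fourier_block :: "nat \<Rightarrow> nat \<Rightarrow> nat \<Rightarrow> complex mat \<Rightarrow> complex mat" where
  "fourier_block k N s X =
     mat k k (\<lambda>(i, j). \<Sum>u\<in>fiber k N j. phase N s (int u - int i) * X $$ (i, u))"

lemma fourier_block_carrier [simp]: "fourier_block k N s X \<in> carrier_mat k k"
  by (simp add: fourier_block_def)

lemma fourier_block_entry:
  "i < k \<Longrightarrow> j < k \<Longrightarrow>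
    fourier_block k N s X $$ (i, j) = (\<Sum>u\<in>fiber k N j. phase N s (int u - int i) * X $$ (i, u))"
  by (simp add: fourier_block_def)

text \<open>Translation by a multiple of \<open>k\<close> changes neither the entries nor the phase
  of the index difference, so a block row can be read off any row of its residue class. A product
  needs this, as its inner index runs through all of \<open>{..<N}\<close>.\<close>

lemma fourier_block_entry_mod:
  assumes X: "block_circulant k N X" and kN: "k dvd N" "N > 0" "k > 0" and v: "v < N" and j: "j < k"
  shows "fourier_block k N s X $$ (v mod k, j) = (\<Sum>u\<in>fiber k N j. phase N s (int u - int v) * X $$ (v, u))"
proof -
  define e where "e = int (v mod k) - int v"
  have e: "int k dvd e" unfolding e_def by (rule dvd_diff_of_mod_eq) simp
  have vk: "v mod k < k" "v mod k < N" using kN v by (auto intro: le_less_trans[OF mod_less_eq_dividend])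
  have "fourier_block k N s X $$ (v mod k, j)
      = (\<Sum>u\<in>fiber k N j. phase N s (int (cyclic_shift N e u) - int (v mod k)) * X $$ (v mod k, cyclic_shift N e u))"
    unfolding fourier_block_entry[OF vk(1) j]
    by (rule sum.reindex_bij_betw[symmetric, OF bij_betw_cyclic_shift_fiber[OF kN(2,1) e]])
  also have "\<dots> = (\<Sum>u\<in>fiber k N j. phase N s (int u - int v) * X $$ (v, u))"
  proof (rule sum.cong[OF HOL.refl])
    fix u assume "u \<in> fiber k N j"
    then have u: "u < N" by (simp add: fiber_def)
    have "[int (cyclic_shift N e u) - int (v mod k) = int u + (int (v mod k) - int v) - int (v mod k)] (mod int N)"
      using cyclic_shift_cong[OF kN(2), of e u] by (intro cong_diff cong_refl) (simp add: e_def)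
    then have 1: "[int (cyclic_shift N e u) - int (v mod k) = int u - int v] (mod int N)" by simp
    then have "[- (int (cyclic_shift N e u) - int (v mod k)) = - (int u - int v)] (mod int N)"
      by (simp only: cong_minus_minus_iff)
    then have 2: "[int (v mod k) - int (cyclic_shift N e u) = int v - int u] (mod int N)" by simp
    show "phase N s (int (cyclic_shift N e u) - int (v mod k)) * X $$ (v mod k, cyclic_shift N e u) = phase N s (int u - int v) * X $$ (v, u)"
      using phase_cong[OF kN(2) 1] block_circulantD[OF X vk(2) cyclic_shift_less[OF kN(2)] v u _ cyclic_shift_mod[OF kN(2,1) e] 2] by simp
  qed
  finally show ?thesis .
qed

text \<open>The phase of \<open>u - i\<close> splits at the inner index \<open>v\<close> into those
  of \<open>v - i\<close> and \<open>u - v\<close>; grouping \<open>v\<close> by residue modulo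
  \<open>k\<close> gives the product of the blocks.\<close>

lemma fourier_block_mult:
  assumes X: "block_circulant k N X" and Y: "block_circulant k N Y" and kN: "k dvd N" "N > 0" "k > 0"
  shows "fourier_block k N s (X * Y) = fourier_block k N s X * fourier_block k N s Y"
proof (rule eq_matI)
  fix i j assume "i < dim_row (fourier_block k N s X * fourier_block k N s Y)"
    "j < dim_col (fourier_block k N s X * fourier_block k N s Y)"
  then have ij: "i < k" "j < k" by (simp_all add: fourier_block_def)
  have iN: "i < N" using ij kN by (meson dvd_imp_le less_le_trans)
  note c = block_circulant_carrier[OF X] block_circulant_carrier[OF Y]
  have "fourier_block k N s (X * Y) $$ (i, j)
      = (\<Sum>u\<in>fiber k N j. \<Sum>v<N. phase N s (int v - int i) * X $$ (i, v) * (phase N s (int u - int v) * Y $$ (v, u)))"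
    unfolding fourier_block_entry[OF ij]
  proof (rule sum.cong[OF HOL.refl])
    fix u assume "u \<in> fiber k N j"
    then have u: "u < N" by (simp add: fiber_def)
    have "phase N s (int u - int i) = phase N s (int v - int i) * phase N s (int u - int v)" for v
      unfolding phase_add[symmetric] by simp
    then show "phase N s (int u - int i) * (X * Y) $$ (i, u)
        = (\<Sum>v<N. phase N s (int v - int i) * X $$ (i, v) * (phase N s (int u - int v) * Y $$ (v, u)))"
      unfolding mat_mult_entry[OF c iN u] sum_distrib_left by (intro sum.cong HOL.refl) (simp add: mult_ac)
  qed
  also have "\<dots> = (\<Sum>v<N. phase N s (int v - int i) * X $$ (i, v) * (\<Sum>u\<in>fiber k N j. phase N s (int u - int v) * Y $$ (v, u)))"
    by (subst sum.swap) (simp only: sum_distrib_left)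
  also have "\<dots> = (\<Sum>v<N. phase N s (int v - int i) * X $$ (i, v) * fourier_block k N s Y $$ (v mod k, j))"
    using fourier_block_entry_mod[OF Y kN _ ij(2)] by (intro sum.cong HOL.refl) simp
  also have "\<dots> = (\<Sum>l<k. \<Sum>v\<in>fiber k N l. phase N s (int v - int i) * X $$ (i, v) * fourier_block k N s Y $$ (v mod k, j))"
    by (rule sum_fibers[OF kN(3), symmetric])
  also have "\<dots> = (\<Sum>l<k. fourier_block k N s X $$ (i, l) * fourier_block k N s Y $$ (l, j))"
    by (intro sum.cong HOL.refl) (simp add: fourier_block_entry[OF ij(1)] sum_distrib_right fiber_def)
  also have "\<dots> = (fourier_block k N s X * fourier_block k N s Y) $$ (i, j)"
    by (rule mat_mult_entry[symmetric]) (use ij in simp_all)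
  finally show "fourier_block k N s (X * Y) $$ (i, j) = (fourier_block k N s X * fourier_block k N s Y) $$ (i, j)" .
qed (simp_all add: fourier_block_def)

lemma fourier_block_one:
  assumes kN: "k dvd N" "N > 0" "k > 0"
  shows "fourier_block k N s (1\<^sub>m N) = 1\<^sub>m k"
proof (rule eq_matI)
  fix i j assume "i < dim_row (1\<^sub>m k :: complex mat)" "j < dim_col (1\<^sub>m k :: complex mat)"
  then have ij: "i < k" "j < k" by simp_all
  have kle: "k \<le> N" using kN by (simp add: dvd_imp_le)
  have "fourier_block k N s (1\<^sub>m N) $$ (i, j) = (\<Sum>u\<in>fiber k N j. if u = i then 1 else 0)"
    unfolding fourier_block_entry[OF ij] using ij kle by (intro sum.cong HOL.refl) (auto simp: fiber_def)
  also have "\<dots> = (1\<^sub>m k) $$ (i, j)"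
    using ij kle by (subst sum.delta) (auto simp: fiber_def)
  finally show "fourier_block k N s (1\<^sub>m N) $$ (i, j) = (1\<^sub>m k) $$ (i, j)" .
qed (simp_all add: fourier_block_def)

lemma fourier_block_pow:
  assumes X: "block_circulant k N X" and kN: "k dvd N" "N > 0" "k > 0"
  shows "block_circulant k N (X ^\<^sub>m j) \<and> fourier_block k N s (X ^\<^sub>m j) = fourier_block k N s X ^\<^sub>m j"
proof (induction j)
  case 0
  have "dim_row X = N" "dim_row (fourier_block k N s X) = k"
    using block_circulant_carrier[OF X] by (auto simp: fourier_block_def)
  then show ?case using fourier_block_one[OF kN] block_circulant_one[OF kN(2)] by simp
next
  case (Suc j)
  then show ?case using block_circulant_mult[OF _ X kN(1,2)] fourier_block_mult[OF _ X kN] by simp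
qed

text \<open>The summands are the powers of \<open>exp (2 pi i t / m)\<close>, an \<open>m\<close>-th
  root of unity different from 1 unless \<open>t = 0\<close>.\<close>

lemma sum_phase:
  assumes "m > 0" "k > 0" "t < m"
  shows "(\<Sum>s<m. phase (k * m) s (int (k * t))) = (if t = 0 then of_nat m else 0)"
proof (cases "t = 0")
  case False
  define z where "z = cis (2 * pi * real t / real m)"
  have ph: "phase (k * m) s (int (k * t)) = z ^ s" for s
  proof -
    have "2 * pi * real s * of_int (int (k * t)) / real (k * m) = real s * (2 * pi * real t / real m)"
      using assms by (simp add: field_simps)
    then show ?thesis unfolding phase_def z_def Complex.DeMoivre by (simp only:)
  qed
  have "z ^ m = cis (2 * pi * real t)" using assms by (simp add: z_def Complex.DeMoivre)
  then have zm: "z ^ m = 1" by (simp add: cis_multiple_2pi)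
  have "z \<noteq> 1"
  proof
    assume "z = 1"
    then have "cos (2 * pi * real t / real m) = 1" by (simp add: z_def complex_eq_iff)
    then obtain x :: int where "2 * pi * real t / real m = of_int x * 2 * pi"
      by (auto simp: cos_one_2pi_int)
    then have "real t = of_int x * real m" using assms by (simp add: field_simps)
    then have "int t = x * int m" by (metis of_int_eq_iff of_int_mult of_int_of_nat_eq)
    then have "int m dvd int t" by simp
    then show False using assms False by (auto dest: dvd_imp_le)
  qed
  then show ?thesis unfolding ph using False zm by (simp add: geometric_sum)
qed (use assms in simp)

text \<open>Summing over the frequencies leaves only \<open>u = i\<close>, with factor
  \<open>m\<close>; this factor counts the \<open>m\<close> equal diagonal entries of
  \<open>X\<close> in the residue class of \<open>i\<close>.\<close>

lemma sum_diag_fourier_blocks: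
  assumes X: "block_circulant k (k * m) X" and k: "k > 0" and m: "m > 0"
  shows "(\<Sum>s<m. \<Sum>i<k. fourier_block k (k * m) s X $$ (i, i)) = (\<Sum>i<k * m. X $$ (i, i))"
proof -
  have inj: "inj_on (\<lambda>t. i + k * t) {..<m}" for i using k by (auto simp: inj_on_def)
  have "(\<Sum>s<m. \<Sum>i<k. fourier_block k (k * m) s X $$ (i, i))
      = (\<Sum>s<m. \<Sum>i<k. \<Sum>t<m. phase (k * m) s (int (k * t)) * X $$ (i, i + k * t))"
    using fourier_block_entry[of _ k _ "k * m"] fiber_mult[OF k]
    by (intro sum.cong HOL.refl) (simp add: sum.reindex[OF inj])
  also have "\<dots> = (\<Sum>i<k. \<Sum>s<m. \<Sum>t<m. phase (k * m) s (int (k * t)) * X $$ (i, i + k * t))"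
    by (rule sum.swap)
  also have "\<dots> = (\<Sum>i<k. of_nat m * X $$ (i, i))"
  proof (rule sum.cong[OF HOL.refl])
    fix i
    have "(\<Sum>s<m. \<Sum>t<m. phase (k * m) s (int (k * t)) * X $$ (i, i + k * t))
        = (\<Sum>t<m. (\<Sum>s<m. phase (k * m) s (int (k * t))) * X $$ (i, i + k * t))"
      by (subst sum.swap) (simp only: sum_distrib_right)
    also have "\<dots> = (\<Sum>t<m. if t = 0 then of_nat m * X $$ (i, i) else 0)"
      using sum_phase[OF m k] by (intro sum.cong HOL.refl) auto
    finally show "(\<Sum>s<m. \<Sum>t<m. phase (k * m) s (int (k * t)) * X $$ (i, i + k * t)) = of_nat m * X $$ (i, i)"
      using m by simp
  qed
  also have "\<dots> = (\<Sum>i<k. \<Sum>u\<in>fiber k (k * m) i. X $$ (u, u))"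
  proof (rule sum.cong[OF HOL.refl])
    fix i assume "i \<in> {..<k}"
    then have i: "i < k" "i < k * m" using m by (auto intro: less_le_trans[of i k])
    have "X $$ (u, u) = X $$ (i, i)" if "u \<in> fiber k (k * m) i" for u
      using that i by (intro block_circulantD[OF X]) (auto simp: fiber_def)
    then show "of_nat m * X $$ (i, i) = (\<Sum>u\<in>fiber k (k * m) i. X $$ (u, u))"
      using card_fiber[OF k i(1), of m] by simp
  qed
  also have "\<dots> = (\<Sum>i<k * m. X $$ (i, i))" by (rule sum_fibers[OF k])
  finally show ?thesis .
qed

text \<open>The substitution for the Hermitian symmetry of blocks: \<open>(u, j)\<close> and
  \<open>(i, i + j - u)\<close> have the same index difference, and the reflection is an involution
  modulo \<open>N\<close>.\<close>

lemma bij_betw_reflection_fiber: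
  assumes "N > 0" "k dvd N" "i < k" "j < k"
  shows "bij_betw (\<lambda>u. nat ((int i + int j - int u) mod int N)) (fiber k N j) (fiber k N i)"
proof -
  let ?r = "\<lambda>u. nat ((int i + int j - int u) mod int N)"
  have r: "?r u < N" "int (?r u) = (int i + int j - int u) mod int N" for u
    using assms(1) by (simp_all add: nat_less_iff)
  have inv: "?r (?r u) = u" if "u < N" for u
  proof -
    have "int (?r (?r u)) = int u" using that unfolding r by (simp add: mod_diff_right_eq)
    then show ?thesis by (simp only: of_nat_eq_iff)
  qed
  have fib: "?r u mod k = i'" if "u mod k = j'" "i' + j' = i + j" "i' < k" for u i' j'
  proof -
    have "int (?r u mod k) = (int i' + int j' - int u) mod int k"
      using assms that unfolding zmod_int r by (simp add: mod_mod_cancel flip: of_nat_add)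
    also have "\<dots> = (int i' + (int j' - int (u mod k))) mod int k"
      unfolding zmod_int by (simp add: mod_simps add_diff_eq)
    also have "\<dots> = int i'" using that by simp
    finally show ?thesis by simp
  qed
  show ?thesis
    by (rule bij_betw_byWitness[where f'="?r"])
       (use r(1) inv fib[of _ j i] fib[of _ i j] assms in \<open>auto simp: fiber_def\<close>)
qed

text \<open>Conjugating the transposed block entry gives a sum down column \<open>j\<close> of
  \<open>X\<close> instead of along row \<open>i\<close>; the reflection carries it back, matching
  entries and phases.\<close>

lemma hermitian_fourier_block:
  assumes X: "block_circulant k N X" and herm: "hermitian_mat N X" and kN: "k dvd N" "N > 0" "k > 0"
  shows "hermitian_mat k (fourier_block k N s X)"
  unfolding hermitian_mat_def
proof (intro conjI allI impI fourier_block_carrier)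
  fix i j assume ij: "i < k" "j < k"
  have kle: "k \<le> N" using kN by (simp add: dvd_imp_le)
  then have ijN: "i < N" "j < N" using ij by simp_all
  have hX: "cnj (X $$ (a, b)) = X $$ (b, a)" if "a < N" "b < N" for a b
  proof -
    have "X $$ (b, a) = cnj (X $$ (a, b))" using herm that unfolding hermitian_mat_def by blast
    then show ?thesis ..
  qed
  let ?r = "\<lambda>u. nat ((int j + int i - int u) mod int N)"
  have "cnj (fourier_block k N s X $$ (j, i)) = (\<Sum>u\<in>fiber k N i. cnj (phase N s (int u - int j)) * X $$ (u, j))"
    unfolding fourier_block_entry[OF ij(2,1)] using hX ijN by (simp add: fiber_def)
  also have "\<dots> = (\<Sum>u\<in>fiber k N i. phase N s (int (?r u) - int i) * X $$ (i, ?r u))"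
  proof (rule sum.cong[OF HOL.refl])
    fix u assume u: "u \<in> fiber k N i"
    have ru: "?r u \<in> fiber k N j"
      using bij_betw_apply[OF bij_betw_reflection_fiber[OF kN(2,1) ij(2,1)] u] .
    have "[int (?r u) = int j + int i - int u] (mod int N)" using kN by (simp add: cong_def)
    then have 1: "[int (?r u) - int i = int j + int i - int u - int i] (mod int N)"
      by (rule cong_diff[OF _ cong_refl])
    then have "[- (int (?r u) - int i) = - (int j + int i - int u - int i)] (mod int N)"
      by (simp only: cong_minus_minus_iff)
    then have "[u - int j = int i - int (?r u)] (mod int N)" by (simp add: cong_sym)
    moreover have "cnj (phase N s (int u - int j)) = phase N s (int (?r u) - int i)"
      unfolding cnj_phase using phase_cong[OF kN(2) 1] by simp
    moreover have "u mod k = i mod k" "j mod k = ?r u mod k" "u < N" "?r u < N"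
      using u ru ij unfolding fiber_def by simp_all
    ultimately show "cnj (phase N s (int u - int j)) * X $$ (u, j) = phase N s (int (?r u) - int i) * X $$ (i, ?r u)"
      using block_circulantD[OF X, of u j i "?r u"] ijN by simp
  qed
  also have "\<dots> = (\<Sum>u\<in>fiber k N j. phase N s (int u - int i) * X $$ (i, u))"
    by (rule sum.reindex_bij_betw[OF bij_betw_reflection_fiber[OF kN(2,1) ij(2,1)]])
  finally show "fourier_block k N s X $$ (i, j) = cnj (fourier_block k N s X $$ (j, i))"
    unfolding fourier_block_entry[OF ij] by simp
qed

lemma smult_pow_mat:
  fixes A :: "'a :: comm_semiring_1 mat"
  assumes A: "A \<in> carrier_mat n n"
  shows "(c \<cdot>\<^sub>m A) ^\<^sub>m j = c ^ j \<cdot>\<^sub>m (A ^\<^sub>m j)"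
proof (induction j)
  case 0
  then show ?case using A by auto
next
  case (Suc j)
  have Aj: "A ^\<^sub>m j \<in> carrier_mat n n" using A by simp
  have "(c \<cdot>\<^sub>m A) ^\<^sub>m Suc j = (c ^ j \<cdot>\<^sub>m (A ^\<^sub>m j)) * (c \<cdot>\<^sub>m A)" using Suc by simp
  also have "\<dots> = c ^ j \<cdot>\<^sub>m (A ^\<^sub>m j * (c \<cdot>\<^sub>m A))"
    by (rule mult_smult_assoc_mat[OF Aj smult_carrier_mat[OF A]])
  also have "\<dots> = c ^ j \<cdot>\<^sub>m (c \<cdot>\<^sub>m (A ^\<^sub>m j * A))"
    by (simp only: mult_smult_distrib[OF Aj A])
  also have "\<dots> = c ^ Suc j \<cdot>\<^sub>m (A ^\<^sub>m Suc j)" by (rule eq_matI) (auto simp: mult_ac)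
  finally show ?case .
qed

text \<open>Each entry of a Fourier block sums \<open>m\<close> entries, so this normalization restores variance one.\<close>

definition normalized_block :: "nat \<Rightarrow> nat \<Rightarrow> nat \<Rightarrow> complex mat \<Rightarrow> complex mat" where
  "normalized_block k m s X = of_real (1 / sqrt (real m)) \<cdot>\<^sub>m fourier_block k (k * m) s X"

lemma hermitian_normalized_block:
  assumes "block_circulant k (k * m) X" "hermitian_mat (k * m) X" "k > 0" "m > 0"
  shows "hermitian_mat k (normalized_block k m s X)"
proof -
  let ?F = "fourier_block k (k * m) s X"
  have F: "hermitian_mat k ?F"
    by (rule hermitian_fourier_block) (use assms in auto)
  show ?thesis
    unfolding hermitian_mat_def normalized_block_def
  proof (intro conjI allI impI smult_carrier_mat fourier_block_carrier)
    fix i j assume ij: "i < k" "j < k"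
    have "?F $$ (i, j) = cnj (?F $$ (j, i))" using F ij unfolding hermitian_mat_def by blast
    moreover have "dim_row ?F = k" "dim_col ?F = k" by (simp_all add: fourier_block_def)
    ultimately show "(of_real (1 / sqrt (real m)) \<cdot>\<^sub>m ?F) $$ (i, j) = cnj ((of_real (1 / sqrt (real m)) \<cdot>\<^sub>m ?F) $$ (j, i))"
      using ij by (simp only: index_smult_mat complex_cnj_mult complex_cnj_complex_of_real)
  qed
qed

lemma sum_mset_image_sum:
  assumes "finite A"
  shows "(\<Sum>x\<in>#(\<Sum>a\<in>A. g a). f x) = (\<Sum>a\<in>A. \<Sum>x\<in>#g a. (f x :: 'b :: comm_monoid_add))"
  using assms by induction auto

text \<open>The factors \<open>1 / sqrt m\<close> of the block and \<open>1 / sqrt k\<close> of its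
  spectrum multiply to the normalization at size \<open>k * m\<close>, so splitting the trace of
  each power over the blocks matches all power sums.\<close>

lemma spectrum_mset_normalized_blocks:
  assumes X: "block_circulant k (k * m) X" and herm: "hermitian_mat (k * m) X" and k: "k > 0" and m: "m > 0"
  shows "spectrum_mset (k * m) X = (\<Sum>s<m. spectrum_mset k (normalized_block k m s X))"
proof (rule multiset_eqI_power_sums)
  fix j
  let ?F = "\<lambda>s. fourier_block k (k * m) s X"
  have kN: "k dvd k * m" "k * m > 0" using k m by simp_all
  note pow = fourier_block_pow[OF X kN k, of j]
  have blk: "(\<Sum>y\<in>#spectrum_mset k (normalized_block k m s X). y ^ j)
      = Re (\<Sum>i<k. (?F s ^\<^sub>m j) $$ (i, i)) / sqrt (real (k * m)) ^ j" for s
  proof -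
    have c: "?F s ^\<^sub>m j \<in> carrier_mat k k" by simp
    have "(normalized_block k m s X ^\<^sub>m j) $$ (i, i) = of_real ((1 / sqrt (real m)) ^ j) * (?F s ^\<^sub>m j) $$ (i, i)"
      if "i < k" for i
      unfolding normalized_block_def smult_pow_mat[OF fourier_block_carrier]
      by (subst index_smult_mat(1)) (simp_all only: of_real_power carrier_matD[OF c] that)
    then have "(\<Sum>i<k. (normalized_block k m s X ^\<^sub>m j) $$ (i, i))
        = of_real ((1 / sqrt (real m)) ^ j) * (\<Sum>i<k. (?F s ^\<^sub>m j) $$ (i, i))"
      by (simp add: sum_distrib_left)
    then have "Re (\<Sum>i<k. (normalized_block k m s X ^\<^sub>m j) $$ (i, i))
        = (1 / sqrt (real m)) ^ j * Re (\<Sum>i<k. (?F s ^\<^sub>m j) $$ (i, i))"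
      by (simp only: Re_complex_of_real times_complex.sel Im_complex_of_real mult_zero_left diff_zero)
    then show ?thesis
      unfolding sum_spectrum_mset_power[OF hermitian_normalized_block[OF X herm k m]]
      by (simp add: real_sqrt_mult power_mult_distrib power_divide)
  qed
  have "(\<Sum>y\<in>#(\<Sum>s<m. spectrum_mset k (normalized_block k m s X)). y ^ j)
      = (\<Sum>s<m. Re (\<Sum>i<k. (?F s ^\<^sub>m j) $$ (i, i)) / sqrt (real (k * m)) ^ j)"
    by (simp only: sum_mset_image_sum[OF finite_lessThan] blk)
  also have "\<dots> = Re (\<Sum>s<m. \<Sum>i<k. fourier_block k (k * m) s (X ^\<^sub>m j) $$ (i, i)) / sqrt (real (k * m)) ^ j"
    using pow by (simp only: Re_sum sum_divide_distrib)
  also have "\<dots> = Re (\<Sum>i<k * m. (X ^\<^sub>m j) $$ (i, i)) / sqrt (real (k * m)) ^ j"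
    using sum_diag_fourier_blocks[OF _ k m, of "X ^\<^sub>m j"] pow by simp
  finally show "(\<Sum>y\<in>#spectrum_mset (k * m) X. y ^ j)
      = (\<Sum>y\<in>#(\<Sum>s<m. spectrum_mset k (normalized_block k m s X)). y ^ j)"
    using sum_spectrum_mset_power[OF herm] by simp
qed

section \<open>Comparison of the two ensembles\<close>

text \<open>Real coordinates of a matrix, since \<open>distr_PiM_eqI_char\<close> concerns finite
  families of real variables.\<close>

definition entry_part :: "complex mat \<Rightarrow> (nat \<times> nat) \<times> bool \<Rightarrow> real" where
  "entry_part X = (\<lambda>(p, b). if b then Im (X $$ p) else Re (X $$ p))"

text \<open>The symmetrization makes the value Hermitian for every argument, so that the measurability of the
  spectral law applies on the whole product space.\<close>

definition hermitian_of_parts :: "nat \<Rightarrow> ((nat \<times> nat) \<times> bool \<Rightarrow> real) \<Rightarrow> complex mat" where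
  "hermitian_of_parts n C = mat n n (\<lambda>(i, j).
     (Complex (C ((i, j), False)) (C ((i, j), True)) + cnj (Complex (C ((j, i), False)) (C ((j, i), True)))) / 2)"

lemma hermitian_hermitian_of_parts: "hermitian_mat n (hermitian_of_parts n C)"
  by (auto simp: hermitian_mat_def hermitian_of_parts_def complex_eq_iff)

lemma hermitian_of_parts_entry_part:
  assumes X: "hermitian_mat n X"
  shows "hermitian_of_parts n (\<lambda>i\<in>({0..<n} \<times> {0..<n}) \<times> UNIV. entry_part X i) = X"
proof (rule eq_matI)
  fix i j assume "i < dim_row X" "j < dim_col X"
  then have ij: "i < n" "j < n" using X unfolding hermitian_mat_def by auto
  then have "cnj (X $$ (j, i)) = X $$ (i, j)" using X unfolding hermitian_mat_def by metis
  moreover have "Complex (Re z) (Im z) = z" for z by simp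
  ultimately show "hermitian_of_parts n (\<lambda>i\<in>({0..<n} \<times> {0..<n}) \<times> UNIV. entry_part X i) $$ (i, j) = X $$ (i, j)"
    using ij by (simp add: hermitian_of_parts_def entry_part_def)
qed (use X in \<open>auto simp: hermitian_mat_def hermitian_of_parts_def\<close>)

lemma hermitian_of_parts_entry_measurable:
  assumes "i < n" "j < n"
  shows "(\<lambda>C. hermitian_of_parts n C $$ (i, j)) \<in> borel_measurable (\<Pi>\<^sub>M i\<in>({0..<n} \<times> {0..<n}) \<times> UNIV. borel)"
proof -
  let ?M = "\<Pi>\<^sub>M i\<in>({0..<n} \<times> {0..<n}) \<times> (UNIV :: bool set). borel :: real measure"
  have [measurable]: "(\<lambda>C. C ((i, j), b)) \<in> borel_measurable ?M" "(\<lambda>C. C ((j, i), b)) \<in> borel_measurable ?M" for b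
    using assms by (auto intro!: measurable_component_singleton)
  have "(\<lambda>C. hermitian_of_parts n C $$ (i, j))
    = (\<lambda>C. complex_of_real ((C ((i, j), False) + C ((j, i), False)) / 2)
        + \<i> * complex_of_real ((C ((i, j), True) - C ((j, i), True)) / 2))"
    using assms by (simp add: fun_eq_iff hermitian_of_parts_def complex_eq_iff)
  moreover have "(\<lambda>C. complex_of_real ((C ((i, j), False) + C ((j, i), False)) / 2)
        + \<i> * complex_of_real ((C ((i, j), True) - C ((j, i), True)) / 2)) \<in> borel_measurable ?M"
    by measurable
  ultimately show ?thesis by simp
qed

lemma (in hermitian_random_matrix) entry_part_measurable:
  assumes "i \<in> ({0..<n} \<times> {0..<n}) \<times> UNIV"
  shows "(\<lambda>\<omega>. entry_part (M \<omega>) i) \<in> borel_measurable P"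
proof -
  obtain l j b where i: "i = ((l, j), b)" by (metis prod.exhaust)
  have "(\<lambda>\<omega>. M \<omega> $$ (l, j)) \<in> borel_measurable P"
    by (rule entry_measurable) (use assms i in auto)
  then show ?thesis unfolding i entry_part_def by (cases b) simp_all
qed

text \<open>Both sides integrate one measurable function of the real coordinates, and the joint laws
  of these coordinates agree by their characteristic functions.\<close>

lemma nn_integral_spectral_law_eqI:
  assumes P: "prob_space P" and Q: "prob_space Q"
    and M: "hermitian_random_matrix n P M" and M': "hermitian_random_matrix n Q M'"
    and char: "\<And>w. (CLINT \<omega>|P. iexp (\<Sum>p\<in>{0..<n} \<times> {0..<n}. Re (w p * M \<omega> $$ p)))
      = (CLINT \<omega>|Q. iexp (\<Sum>p\<in>{0..<n} \<times> {0..<n}. Re (w p * M' \<omega> $$ p)))"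
    and S: "S \<in> sets borel"
  shows "(\<integral>\<^sup>+\<omega>. emeasure (spectral_law n (M \<omega>)) S \<partial>P) = (\<integral>\<^sup>+\<omega>. emeasure (spectral_law n (M' \<omega>)) S \<partial>Q)"
proof -
  let ?I = "({0..<n} \<times> {0..<n}) \<times> (UNIV :: bool set)"
  let ?PM = "\<Pi>\<^sub>M i\<in>?I. borel :: real measure"
  let ?F = "\<lambda>C. emeasure (spectral_law n (hermitian_of_parts n C)) S"
  interpret M: hermitian_random_matrix n P M by fact
  interpret M': hermitian_random_matrix n Q M' by fact
  interpret H: hermitian_random_matrix n ?PM "hermitian_of_parts n"
    by unfold_locales (auto intro: M.pos hermitian_hermitian_of_parts hermitian_of_parts_entry_measurable)
  have F: "?F \<in> borel_measurable ?PM"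
    using measurable_emeasure_subprob_algebra[OF S] H.spectral_law_measurable by (rule measurable_compose[rotated])
  \<comment> \<open>Real functionals of the coordinates are real parts of complex-linear ones:
    \<open>a * Re z + b * Im z\<close> is \<open>Re (Complex a (- b) * z)\<close>.\<close>
  have lin: "(\<Sum>i\<in>?I. v i * entry_part X i)
      = (\<Sum>p\<in>{0..<n} \<times> {0..<n}. Re (Complex (v (p, False)) (- v (p, True)) * X $$ p))" for v X
  proof -
    have "(\<Sum>i\<in>?I. v i * entry_part X i) = (\<Sum>p\<in>{0..<n} \<times> {0..<n}. \<Sum>b\<in>UNIV. v (p, b) * entry_part X (p, b))"
      by (subst sum.cartesian_product) (simp add: case_prod_unfold)
    also have "\<dots> = (\<Sum>p\<in>{0..<n} \<times> {0..<n}. Re (Complex (v (p, False)) (- v (p, True)) * X $$ p))"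
      by (intro sum.cong HOL.refl) (simp add: UNIV_bool entry_part_def)
    finally show ?thesis .
  qed
  have mM: "(\<lambda>\<omega>. \<lambda>i\<in>?I. entry_part (M \<omega>) i) \<in> P \<rightarrow>\<^sub>M ?PM"
    by (rule measurable_restrict) (rule M.entry_part_measurable)
  have mM': "(\<lambda>\<omega>. \<lambda>i\<in>?I. entry_part (M' \<omega>) i) \<in> Q \<rightarrow>\<^sub>M ?PM"
    by (rule measurable_restrict) (rule M'.entry_part_measurable)
  have law: "distr P ?PM (\<lambda>\<omega>. \<lambda>i\<in>?I. entry_part (M \<omega>) i) = distr Q ?PM (\<lambda>\<omega>. \<lambda>i\<in>?I. entry_part (M' \<omega>) i)"
    by (rule distr_PiM_eqI_char[OF P Q, where X="\<lambda>i \<omega>. entry_part (M \<omega>) i" and Y="\<lambda>i \<omega>. entry_part (M' \<omega>) i"])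
       (simp_all only: finite_cartesian_product finite_atLeastLessThan finite M.entry_part_measurable M'.entry_part_measurable lin char)
  have "(\<integral>\<^sup>+\<omega>. emeasure (spectral_law n (M \<omega>)) S \<partial>P) = (\<integral>\<^sup>+\<omega>. ?F (\<lambda>i\<in>?I. entry_part (M \<omega>) i) \<partial>P)"
    by (rule nn_integral_cong) (simp only: hermitian_of_parts_entry_part[OF M.herm])
  also have "\<dots> = (\<integral>\<^sup>+C. ?F C \<partial>distr P ?PM (\<lambda>\<omega>. \<lambda>i\<in>?I. entry_part (M \<omega>) i))"
    by (rule nn_integral_distr[symmetric, OF mM]) (simp add: F)
  also have "\<dots> = (\<integral>\<^sup>+\<omega>. ?F (\<lambda>i\<in>?I. entry_part (M' \<omega>) i) \<partial>Q)"
    unfolding law by (rule nn_integral_distr[OF mM']) (simp add: F)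
  also have "\<dots> = (\<integral>\<^sup>+\<omega>. emeasure (spectral_law n (M' \<omega>)) S \<partial>Q)"
    by (rule nn_integral_cong) (simp only: hermitian_of_parts_entry_part[OF M'.herm])
  finally show ?thesis .
qed

context companion
begin

lemma hermitian: "\<omega> \<in> space P \<Longrightarrow> hermitian_mat n (M \<omega>)"
  unfolding hermitian_mat_def using carrier cnj_entry by force

lemma hermitian_random_matrix: "n > 0 \<Longrightarrow> hermitian_random_matrix n P M"
  by unfold_locales (auto intro: hermitian entry_measurable)

lemma block_circulant_sample:
  assumes "\<omega> \<in> space P"
  shows "block_circulant k n (M \<omega>)"
  unfolding block_circulant_def
proof (intro conjI allI impI carrier assms)
  fix i j i' j' assume *: "i < n" "j < n" "i' < n" "j' < n" "i mod k = i' mod k" "j mod k = j' mod k"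
    "[int i - int j = int i' - int j'] (mod int n)"
  then have "same_entry k f n (i, j) (i', j')"
    by (simp add: same_entry_def link_at_def flip: zmod_int)
  then show "M \<omega> $$ (i, j) = M \<omega> $$ (i', j')"
    by (intro same_entryD assms) (use * in auto)
qed

end

section \<open>The blocks of the large ensemble against the small ensemble\<close>

locale companion_pair =
  A: companion k k f P A + B: companion k N f Q B
  for k N :: nat and f :: "int \<times> int \<Rightarrow> int" and P :: "'a measure" and A :: "'a \<Rightarrow> complex mat"
    and Q :: "'b measure" and B :: "'b \<Rightarrow> complex mat" +
  fixes m :: nat
  assumes N_def: "N = k * m" and k_pos: "k > 0" and m_pos: "m > 0"
begin

lemma kN: "k dvd N" "N > 0" "k \<le> N"
  using N_def k_pos m_pos by simp_all

lemma normalized_block_entry: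
  assumes "i < k" "j < k"
  shows "normalized_block k m s X $$ (i, j) = (\<Sum>u\<in>fiber k N j. phase N s (int u - int i) / sqrt (real m) * X $$ (i, u))"
proof -
  have d: "dim_row (fourier_block k N s X) = k" "dim_col (fourier_block k N s X) = k"
    by (simp_all add: fourier_block_def)
  have "normalized_block k m s X $$ (i, j) = of_real (1 / sqrt (real m)) * fourier_block k N s X $$ (i, j)"
    unfolding normalized_block_def N_def[symmetric] by (rule index_smult_mat(1)) (simp_all only: d assms)
  then show ?thesis by (simp add: fourier_block_entry[OF assms] sum_distrib_left)
qed

text \<open>Once the rows are fixed, the conserved difference leaves a single candidate
  \<open>u'\<close> for each \<open>u\<close>; this collapses the double sum in the block
  covariance.\<close>

lemma parity_linked_fiber_iff:
  assumes p: "i < k" "j < k" and q: "i' < k" "j' < k" and u: "u \<in> fiber k N j" and u': "u' \<in> fiber k N j'"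
  shows "parity_linked k f N True (i, u) (i', u') \<longleftrightarrow>
    parity_linked k f k True (i, j) (i', j') \<and> u' = cyclic_shift N (int i' - int i) u"
proof -
  have b: "i < N" "i' < N" "u < N" "u' < N" "u mod k = j" "u' mod k = j'"
    using p q u u' kN by (auto simp: fiber_def)
  have "[int i' - int u' = int i - int u] (mod int N) \<longleftrightarrow> [int u' = int u + (int i' - int i)] (mod int N)"
    by (simp add: cong_iff_dvd_diff) (metis (no_types, opaque_lifting) add_diff_eq diff_diff_eq2 diff_add_eq dvd_diff_commute add.commute)
  also have "\<dots> \<longleftrightarrow> u' = cyclic_shift N (int i' - int i) u"
  proof
    assume "[int u' = int u + (int i' - int i)] (mod int N)"
    then have "int u' = int (cyclic_shift N (int i' - int i) u)"
      using b unfolding int_cyclic_shift[OF kN(2)] by (simp add: cong_def)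
    then show "u' = cyclic_shift N (int i' - int i) u" by (simp only: of_nat_eq_iff)
  qed (simp add: cyclic_shift_cong[OF kN(2)])
  finally show ?thesis
    using parity_linked_iff[OF kN(1) k_pos kN(2) b(1,3,2,4)] p q b by simp
qed

text \<open>That candidate lies in the required residue class because an even chain of size
  \<open>k\<close> preserves the index difference modulo \<open>k\<close>.\<close>

lemma cyclic_shift_fiber:
  assumes pl: "parity_linked k f k True (i, j) (i', j')" and u: "u \<in> fiber k N j"
  shows "cyclic_shift N (int i' - int i) u \<in> fiber k N j'"
proof -
  have g: "i < k" "j < k" "i' < k" "j' < k" using parity_linked_grid[OF pl] by auto
  have d: "[int i' - int j' = int i - int j] (mod int k)"
    using parity_linked_project[OF pl dvd_refl k_pos] by (simp only: if_True fst_conv snd_conv mult_1_left)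
  have "int (cyclic_shift N (int i' - int i) u mod k) = (int u + (int i' - int i)) mod int k"
    using kN by (simp add: zmod_int int_cyclic_shift mod_mod_cancel)
  also have "\<dots> = (int (u mod k) + (int i' - int i)) mod int k" by (simp add: zmod_int mod_add_left_eq)
  also have "\<dots> = (int j + (int i' - int i)) mod int k" using u by (simp add: fiber_def)
  also have "\<dots> = int j' mod int k"
  proof -
    have "int k dvd int i' - int j' - (int i - int j)" using d by (simp only: cong_iff_dvd_diff)
    then have "int k dvd int j + (int i' - int i) - int j'" by (simp add: algebra_simps)
    then show ?thesis by (simp add: mod_eq_dvd_iff)
  qed
  also have "\<dots> = int j'" using g by simp
  finally show ?thesis using cyclic_shift_less[OF kN(2)] by (simp add: fiber_def)
qed

lemma normalized_block_product:
  assumes "i < k" "j < k" "i' < k" "j' < k"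
  shows "normalized_block k m s X $$ (i, j) * cnj (normalized_block k m s X $$ (i', j'))
    = (\<Sum>u\<in>fiber k N j. \<Sum>u'\<in>fiber k N j'.
        phase N s (int u - int i) * cnj (phase N s (int u' - int i')) / real m * (X $$ (i, u) * cnj (X $$ (i', u'))))"
proof -
  have "complex_of_real (sqrt (real m)) * complex_of_real (sqrt (real m)) = of_nat m"
    by (simp flip: of_real_mult)
  then show ?thesis
    unfolding normalized_block_entry[OF assms(1,2)] normalized_block_entry[OF assms(3,4)] cnj_sum sum_product
    by (intro sum.cong HOL.refl) (simp add: field_simps)
qed

lemma normalized_block_integrable:
  assumes "i < k" "j < k" "i' < k" "j' < k"
  shows "integrable Q (\<lambda>\<omega>. normalized_block k m s (B \<omega>) $$ (i, j) * cnj (normalized_block k m s (B \<omega>) $$ (i', j')))"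
  unfolding normalized_block_product[OF assms]
  by (intro Bochner_Integration.integrable_sum integrable_mult_right B.integrable_prod)
     (use assms kN in \<open>auto simp: fiber_def\<close>)

text \<open>If the block positions are evenly linked, each of the \<open>m\<close> columns
  \<open>u\<close> has exactly one partner, and every such pair contributes \<open>1 / m\<close>;
  otherwise no pair contributes.\<close>

lemma normalized_block_covariance:
  assumes "i < k" "j < k" "i' < k" "j' < k"
  shows "(CLINT \<omega>|Q. normalized_block k m s (B \<omega>) $$ (i, j) * cnj (normalized_block k m s (B \<omega>) $$ (i', j')))
    = of_bool (parity_linked k f k True (i, j) (i', j'))"
proof -
  let ?c = "\<lambda>u u'. phase N s (int u - int i) * cnj (phase N s (int u' - int i')) / real m"
  let ?E = "parity_linked k f k True (i, j) (i', j')"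
  have g: "(i, u) \<in> {0..<N} \<times> {0..<N}" "(i', u') \<in> {0..<N} \<times> {0..<N}"
    if "u \<in> fiber k N j" "u' \<in> fiber k N j'" for u u'
    using that assms kN by (auto simp: fiber_def)
  have int: "integrable Q (\<lambda>\<omega>. ?c u u' * (B \<omega> $$ (i, u) * cnj (B \<omega> $$ (i', u'))))"
    if "u \<in> fiber k N j" "u' \<in> fiber k N j'" for u u'
    by (intro integrable_mult_right B.integrable_prod g[OF that])
  have "(CLINT \<omega>|Q. normalized_block k m s (B \<omega>) $$ (i, j) * cnj (normalized_block k m s (B \<omega>) $$ (i', j')))
    = (\<Sum>u\<in>fiber k N j. \<Sum>u'\<in>fiber k N j'. (CLINT \<omega>|Q. ?c u u' * (B \<omega> $$ (i, u) * cnj (B \<omega> $$ (i', u')))))"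
    unfolding normalized_block_product[OF assms]
    by (subst Bochner_Integration.integral_sum, intro Bochner_Integration.integrable_sum int, assumption+)
       (intro sum.cong HOL.refl Bochner_Integration.integral_sum int)
  also have "\<dots> = (\<Sum>u\<in>fiber k N j. \<Sum>u'\<in>fiber k N j'. ?c u u' * of_bool (parity_linked k f N True (i, u) (i', u')))"
    by (intro sum.cong HOL.refl) (simp only: integral_mult_right_zero B.covariance[OF g])
  also have "\<dots> = (\<Sum>u\<in>fiber k N j. \<Sum>u'\<in>fiber k N j'.
      if u' = cyclic_shift N (int i' - int i) u then of_bool ?E / of_nat m else 0)"
  proof (intro sum.cong HOL.refl)
    fix u u' assume u: "u \<in> fiber k N j" "u' \<in> fiber k N j'"
    \<comment> \<open>For partners \<open>u' - i'\<close> and \<open>u - i\<close> agree modulo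
      \<open>N\<close>, so a phase meets its own conjugate.\<close>
    have "?c u u' = 1 / of_nat m" if "u' = cyclic_shift N (int i' - int i) u"
    proof -
      have "[int u' - int i' = int u + (int i' - int i) - int i'] (mod int N)"
        unfolding that by (intro cong_diff cong_refl cyclic_shift_cong kN)
      then have "phase N s (int u' - int i') = phase N s (int u - int i)"
        by (intro phase_cong kN) simp
      then show ?thesis by simp
    qed
    then show "?c u u' * of_bool (parity_linked k f N True (i, u) (i', u'))
        = (if u' = cyclic_shift N (int i' - int i) u then of_bool ?E / of_nat m else 0)"
      unfolding parity_linked_fiber_iff[OF assms u] by auto
  qed
  also have "\<dots> = (\<Sum>u\<in>fiber k N j. of_bool ?E / of_nat m)"
  proof (rule sum.cong[OF HOL.refl])
    fix u assume u: "u \<in> fiber k N j"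
    have "finite (fiber k N j')" by (simp add: fiber_def)
    then show "(\<Sum>u'\<in>fiber k N j'. if u' = cyclic_shift N (int i' - int i) u then of_bool ?E / of_nat m else 0)
        = (of_bool ?E / of_nat m :: complex)"
      using cyclic_shift_fiber[OF _ u, of i i' j'] by (cases ?E) simp_all
  qed
  also have "\<dots> = of_bool ?E" using card_fiber[OF k_pos assms(2), of m] m_pos by (simp add: N_def)
  finally show ?thesis .
qed

lemma hermitian_normalized_block_sample:
  assumes "\<omega> \<in> space Q"
  shows "hermitian_mat k (normalized_block k m s (B \<omega>))"
  by (rule hermitian_normalized_block[OF _ _ k_pos m_pos])
     (use B.block_circulant_sample[OF assms] B.hermitian[OF assms] in \<open>simp_all only: N_def\<close>)

lemma normalized_block_measurable:
  assumes "i < k" "j < k"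
  shows "(\<lambda>\<omega>. normalized_block k m s (B \<omega>) $$ (i, j)) \<in> borel_measurable Q"
  unfolding normalized_block_entry[OF assms]
  by (intro borel_measurable_sum borel_measurable_times borel_measurable_const B.entry_measurable)
     (use assms kN in \<open>auto simp: fiber_def\<close>)

lemma hermitian_random_matrix_normalized_block:
  "hermitian_random_matrix k Q (\<lambda>\<omega>. normalized_block k m s (B \<omega>))"
  by unfold_locales (rule k_pos hermitian_normalized_block_sample normalized_block_measurable; assumption)+

text \<open>A real-linear functional of a block is one of the whole matrix, hence Gaussian.\<close>

lemma normalized_block_linear:
  "(\<Sum>p\<in>{0..<k} \<times> {0..<k}. Re (w p * normalized_block k m s X $$ p))
    = (\<Sum>p\<in>{0..<N} \<times> {0..<N}. Re ((if fst p < k then w (fst p, snd p mod k)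
        * (phase N s (int (snd p) - int (fst p)) / sqrt (real m)) else 0) * X $$ p))"
proof -
  let ?v = "\<lambda>i u. w (i, u mod k) * (phase N s (int u - int i) / sqrt (real m))"
  have "(\<Sum>p\<in>{0..<k} \<times> {0..<k}. Re (w p * normalized_block k m s X $$ p))
      = (\<Sum>i<k. \<Sum>j<k. Re (w (i, j) * normalized_block k m s X $$ (i, j)))"
    by (simp add: sum.cartesian_product lessThan_atLeast0)
  also have "\<dots> = (\<Sum>i<k. \<Sum>j<k. \<Sum>u\<in>fiber k N j. Re (?v i u * X $$ (i, u)))"
  proof (intro sum.cong HOL.refl)
    fix i j assume ij: "i \<in> {..<k}" "j \<in> {..<k}"
    have "w (i, j) * normalized_block k m s X $$ (i, j) = (\<Sum>u\<in>fiber k N j. ?v i u * X $$ (i, u))"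
      using ij by (simp add: normalized_block_entry sum_distrib_left fiber_def mult.assoc)
    then show "Re (w (i, j) * normalized_block k m s X $$ (i, j)) = (\<Sum>u\<in>fiber k N j. Re (?v i u * X $$ (i, u)))"
      by (simp only: Re_sum)
  qed
  also have "\<dots> = (\<Sum>i<k. \<Sum>u<N. Re (?v i u * X $$ (i, u)))"
    by (simp only: sum_fibers[OF k_pos])
  \<comment> \<open>Only the first \<open>k\<close> rows enter a block; the other rows get
    coefficient 0, making this a functional of the full grid.\<close>
  also have "\<dots> = (\<Sum>i<N. if i < k then (\<Sum>u<N. Re (?v i u * X $$ (i, u))) else 0)"
    using kN by (intro sum.mono_neutral_cong_left) auto
  also have "\<dots> = (\<Sum>i<N. \<Sum>u<N. Re ((if i < k then ?v i u else 0) * X $$ (i, u)))"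
  proof (rule sum.cong[OF HOL.refl])
    fix i
    show "(if i < k then (\<Sum>u<N. Re (?v i u * X $$ (i, u))) else 0)
        = (\<Sum>u<N. Re ((if i < k then ?v i u else 0) * X $$ (i, u)))"
      by (cases "i < k") (simp_all only: if_True if_False mult_zero_left zero_complex.sel sum.neutral_const)
  qed
  also have "\<dots> = (\<Sum>p\<in>{0..<N} \<times> {0..<N}. Re ((if fst p < k then ?v (fst p) (snd p) else 0) * X $$ p))"
    by (simp add: sum.cartesian_product lessThan_atLeast0 case_prod_unfold)
  finally show ?thesis .
qed

text \<open>Both sides are Gaussian exponentials of a second moment, and the second moments agree by
  equal covariances and Hermitian symmetry.\<close>

lemma char_normalized_block:
  "(CLINT \<omega>|Q. iexp (\<Sum>p\<in>{0..<k} \<times> {0..<k}. Re (w p * normalized_block k m s (B \<omega>) $$ p)))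
    = (CLINT \<omega>|P. iexp (\<Sum>p\<in>{0..<k} \<times> {0..<k}. Re (w p * A \<omega> $$ p)))"
proof -
  let ?D = "\<lambda>p \<omega>. normalized_block k m s (B \<omega>) $$ p"
  let ?\<tau> = "\<lambda>p::nat \<times> nat. (snd p, fst p)"
  let ?C = "\<lambda>p q. of_bool (parity_linked k f k True p q) :: complex"
  have tr: "?\<tau> p \<in> {0..<k} \<times> {0..<k}" if "p \<in> {0..<k} \<times> {0..<k}" for p
    using that by auto
  have hD: "?D (?\<tau> p) \<omega> = cnj (?D p \<omega>)" if p: "p \<in> {0..<k} \<times> {0..<k}" and \<omega>: "\<omega> \<in> space Q" for p \<omega>
  proof -
    have *: "\<forall>i<k. \<forall>j<k. ?D (i, j) \<omega> = cnj (?D (j, i) \<omega>)"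
      using hermitian_normalized_block_sample[OF \<omega>] unfolding hermitian_mat_def by blast
    obtain i j where ij: "p = (i, j)" by (cases p)
    then have "?D (j, i) \<omega> = cnj (?D (i, j) \<omega>)" using p by (intro *[rule_format]) simp_all
    then show ?thesis by (simp only: ij fst_conv snd_conv)
  qed
  have hA: "A \<omega> $$ (?\<tau> p) = cnj (A \<omega> $$ p)" if p: "p \<in> {0..<k} \<times> {0..<k}" and \<omega>: "\<omega> \<in> space P" for p \<omega>
  proof -
    obtain i j where "p = (i, j)" by (cases p)
    then show ?thesis using A.cnj_entry[OF \<omega>, of i j] p by simp
  qed
  have intD: "integrable Q (\<lambda>\<omega>. ?D p \<omega> * cnj (?D q \<omega>))" and covD: "(CLINT \<omega>|Q. ?D p \<omega> * cnj (?D q \<omega>)) = ?C p q"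
    if "p \<in> {0..<k} \<times> {0..<k}" "q \<in> {0..<k} \<times> {0..<k}" for p q
  proof -
    obtain i j i' j' where pq: "p = (i, j)" "q = (i', j')" by (cases p; cases q)
    then have b: "i < k" "j < k" "i' < k" "j' < k" using that by simp_all
    show "integrable Q (\<lambda>\<omega>. ?D p \<omega> * cnj (?D q \<omega>))" unfolding pq by (rule normalized_block_integrable[OF b])
    show "(CLINT \<omega>|Q. ?D p \<omega> * cnj (?D q \<omega>)) = ?C p q" unfolding pq by (rule normalized_block_covariance[OF b])
  qed
  have moments: "(LINT \<omega>|Q. (\<Sum>p\<in>{0..<k} \<times> {0..<k}. Re (w p * ?D p \<omega>))\<^sup>2)
      = (LINT \<omega>|P. (\<Sum>p\<in>{0..<k} \<times> {0..<k}. Re (w p * A \<omega> $$ p))\<^sup>2)"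
    by (rule trans[OF
          second_moment_Re_sum[where \<tau>="?\<tau>" and D="?D" and C="?C", OF hD tr intD covD]
          second_moment_Re_sum[where \<tau>="?\<tau>" and D="\<lambda>p \<omega>. A \<omega> $$ p" and C="?C", symmetric,
            OF hA tr A.integrable_prod A.covariance]])
  have "(CLINT \<omega>|Q. iexp (\<Sum>p\<in>{0..<k} \<times> {0..<k}. Re (w p * ?D p \<omega>)))
      = of_real (exp (- (LINT \<omega>|Q. (\<Sum>p\<in>{0..<k} \<times> {0..<k}. Re (w p * ?D p \<omega>))\<^sup>2) / 2))"
    unfolding normalized_block_linear by (rule B.char_linear)
  then show ?thesis unfolding moments A.char_linear .
qed

text \<open>The spectrum splits into \<open>m\<close> parts of equal size \<open>k\<close>, so a
  uniform draw from it first picks a block with weight \<open>1 / m\<close>.\<close>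

lemma emeasure_spectral_law_blocks:
  assumes \<omega>: "\<omega> \<in> space Q" and S: "S \<in> sets borel"
  shows "emeasure (spectral_law N (B \<omega>)) S
    = (\<Sum>s<m. ennreal (1 / real m) * emeasure (spectral_law k (normalized_block k m s (B \<omega>))) S)"
proof -
  let ?D = "\<lambda>s. normalized_block k m s (B \<omega>)"
  let ?ind = "\<lambda>R. \<Sum>y\<in>#R. indicator S y :: real"
  have nonneg: "?ind R \<ge> 0" for R by (induction R) auto
  have scaled_sum: "ennreal (\<Sum>s<m. 1 / real m * g s) = (\<Sum>s<m. ennreal (1 / real m) * ennreal (g s))"
    if "\<And>s. g s \<ge> 0" for g :: "nat \<Rightarrow> real"
    by (subst sum_ennreal[symmetric]) (simp_all add: that flip: ennreal_mult)
  have D: "?D s \<in> carrier_mat k k" for s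
    using hermitian_normalized_block_sample[OF \<omega>] unfolding hermitian_mat_def by blast
  have spec: "spectrum_mset N (B \<omega>) = (\<Sum>s<m. spectrum_mset k (?D s))"
    using spectrum_mset_normalized_blocks[OF _ _ k_pos m_pos] B.block_circulant_sample[OF \<omega>] B.hermitian[OF \<omega>]
    unfolding N_def by blast
  have "emeasure (spectral_law N (B \<omega>)) S = ennreal (?ind (spectrum_mset N (B \<omega>)) / real N)"
    by (rule emeasure_spectral_law[OF kN(2) B.carrier[OF \<omega>] S])
  also have "?ind (spectrum_mset N (B \<omega>)) / real N = (\<Sum>s<m. 1 / real m * (?ind (spectrum_mset k (?D s)) / real k))"
    unfolding spec sum_mset_image_sum[OF finite_lessThan] sum_divide_distrib
    by (intro sum.cong HOL.refl) (simp only: N_def of_nat_mult times_divide_times_eq mult_1_left mult.commute)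
  also have "ennreal \<dots> = (\<Sum>s<m. ennreal (1 / real m) * ennreal (?ind (spectrum_mset k (?D s)) / real k))"
    by (rule scaled_sum, rule divide_nonneg_nonneg, rule nonneg, rule of_nat_0_le_iff)
  also have "\<dots> = (\<Sum>s<m. ennreal (1 / real m) * emeasure (spectral_law k (?D s)) S)"
    by (simp only: emeasure_spectral_law[OF k_pos D S])
  finally show ?thesis .
qed

text \<open>After averaging over the samples each of the \<open>m\<close> blocks gives the same mass
  as the small ensemble, so the mixture is that mass itself.\<close>

lemma eigenvalue_distribution_eq: "eigenvalue_distribution k P A = eigenvalue_distribution N Q B"
proof -
  interpret HA: hermitian_random_matrix k P A by (rule A.hermitian_random_matrix[OF k_pos])
  interpret HB: hermitian_random_matrix N Q B by (rule B.hermitian_random_matrix[OF kN(2)])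
  note P = A.prob_space_axioms and Q = B.prob_space_axioms
  show ?thesis
  proof (rule measure_eqI)
    show "sets (eigenvalue_distribution k P A) = sets (eigenvalue_distribution N Q B)"
      by (simp only: HA.sets_eigenvalue_distribution[OF P] HB.sets_eigenvalue_distribution[OF Q])
    fix S assume "S \<in> sets (eigenvalue_distribution k P A)"
    then have S: "S \<in> sets borel" by (simp only: HA.sets_eigenvalue_distribution[OF P])
    let ?a = "\<integral>\<^sup>+\<omega>. emeasure (spectral_law k (A \<omega>)) S \<partial>P"
    have meas: "(\<lambda>\<omega>. emeasure (spectral_law k (normalized_block k m s (B \<omega>))) S) \<in> borel_measurable Q" for s
      using hermitian_random_matrix.spectral_law_measurable[OF hermitian_random_matrix_normalized_block]
        measurable_emeasure_subprob_algebra[OF S] by (rule measurable_compose)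
    have "emeasure (eigenvalue_distribution N Q B) S = (\<integral>\<^sup>+\<omega>. emeasure (spectral_law N (B \<omega>)) S \<partial>Q)"
      by (rule HB.emeasure_eigenvalue_distribution[OF Q S])
    also have "\<dots> = (\<integral>\<^sup>+\<omega>. (\<Sum>s<m. ennreal (1 / real m) * emeasure (spectral_law k (normalized_block k m s (B \<omega>))) S) \<partial>Q)"
      by (rule nn_integral_cong) (rule emeasure_spectral_law_blocks[OF _ S])
    also have "\<dots> = (\<Sum>s<m. ennreal (1 / real m) * (\<integral>\<^sup>+\<omega>. emeasure (spectral_law k (normalized_block k m s (B \<omega>))) S \<partial>Q))"
      using meas by (subst nn_integral_sum) (auto simp: nn_integral_cmult)
    also have "\<dots> = (\<Sum>s<m. ennreal (1 / real m) * ?a)"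
      by (simp only: nn_integral_spectral_law_eqI[OF Q P hermitian_random_matrix_normalized_block
            HA.hermitian_random_matrix_axioms char_normalized_block S])
    also have "\<dots> = of_nat m * ennreal (1 / real m) * ?a" by (simp add: mult.assoc)
    also have "of_nat m * ennreal (1 / real m) = 1"
      using m_pos by (simp add: ennreal_of_nat_eq_real_of_nat ennreal_mult[symmetric])
    finally show "emeasure (eigenvalue_distribution k P A) S = emeasure (eigenvalue_distribution N Q B) S"
      by (simp only: HA.emeasure_eigenvalue_distribution[OF P S] mult_1_left)
  qed
qed

end

theorem theorem2p10:
  fixes k N :: nat
    and f :: "int \<times> int \<Rightarrow> int"
    and P :: "'a measure" and A :: "'a \<Rightarrow> complex mat"
    and Q :: "'b measure" and B :: "'b \<Rightarrow> complex mat"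
  assumes "k > 0" and "N > 0" and "k dvd N"
    and "link_function k f"
    and "complex_companion_ensemble k f k P A"
    and "complex_companion_ensemble k f N Q B"
  shows "eigenvalue_distribution k P A = eigenvalue_distribution N Q B"
proof -
  obtain m where m: "N = k * m" using \<open>k dvd N\<close> by (elim dvdE)
  interpret companion_pair k N f P A Q B m
    by unfold_locales (use assms m in auto)
  show ?thesis by (rule eigenvalue_distribution_eq)
qed

end
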